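(* Let $n_L$ be fixed and consider a sequence of asymmetric hub models with $n\to\infty$, $T\to\infty$, satisfying the standing assumption on $\rho$ in the context. Let $d,v\in(0,1]$ (possibly depending on the index of the sequence) be such that: (i) for each $i=1,\dots,n_L$ there exists a set $V_i\subset\{1,\dots,n\}$ with $|V_i|\ge vn/n_L$ and $A_{ij}-A_{i'j}\ge d$ for all $j\in V_i$ and all $i'\in\{1,\dots,n_L\}$, $i'\ne i$; (ii) $A_{ii'}$ is bounded away from $1$ (by a constant) for all $i,i'\in\{1,\dots,n_L\}$, $i\ne i'$. If $(\log T)/(d^2vT)=o(1)$, $d^4v^2n\to\infty$ and $(\log n)/T=o(1)$, then $$\max_{i\in\{1,\dots,n_L\},\,j\in\{1,\dots,n\}}\left|\hat A_{ij}^{\hat z}-A_{ij}\right|=o_p(1).$$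
   Context: Asymmetric hub model: nodes $1,\dots,n$; leaders (possible hubs) $1,\dots,n_L$ with $n_L\le n$; parameters $\rho=(\rho_1,\dots,\rho_{n_L})$ with $\rho_i\ge0$, $\sum_i\rho_i=1$, and $A\in[0,1]^{n_L\times n}$ with $A_{ii}=1$ for $i\le n_L$. Independently for $t=1,\dots,T$, a latent hub $z_*^{(t)}\in\{1,\dots,n_L\}$ is drawn with $\mathbb P(z_*^{(t)}=i)=\rho_i$, and given $z_*^{(t)}=i$ the variables $G_j^{(t)}\in\{0,1\}$, $j=1,\dots,n$, are independent with $\mathbb P(G_j^{(t)}=1\mid z_*^{(t)}=i)=A_{ij}$. Only $G$ is observed. Profile likelihood estimator: for an assignment $z=(z^{(1)},\dots,z^{(T)})\in\{1,\dots,n_L\}^T$ let $t_i=\sum_t1(z^{(t)}=i)$, $\hat A^z_{ij}=\frac{1}{t_i}\sum_tG_j^{(t)}1(z^{(t)}=i)$ (set to $0$, say, if $t_i=0$), and $$L_G(z)=\sum_{t=1}^T\sum_{j=1}^n G_j^{(t)}\log\hat A^z_{z^{(t)},j}+(1-G_j^{(t)})\log(1-\hat A^z_{z^{(t)},j}),\qquad 0\log0=0.$$ An assignment is feasible if $G^{(t)}_{z^{(t)}}=1$ for every $t$ (the assigned hub appears in its group). $\hat z$ is a maximizer of $L_G(z)$ over feasible assignments, and $\hat A^{\hat z}$ is $\hat A^z$ at $z=\hat z$. Asymptotics: $n,T,\rho,A,d,v$ vary along a sequence while $n_L$ is fixed; $o(1)$ and $o_p(1)$ are along this sequence, and "constant"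 means independent of the sequence index. Standing assumption: $\min_i\rho_i=c_{\min*}/n_L$ and $\max_i\rho_i=c_{\max*}/n_L$ with positive constants $c_{\min*},c_{\max*}$. *)

theory Defs
  imports "HOL-Probability.Probability"
begin

text \<open>
  Nodes are \<open>1, \<dots>, n\<close>, possible hubs are \<open>1, \<dots>, nL\<close>, observations are \<open>1, \<dots>, T\<close>;
  \<open>Z t \<omega>\<close> is the latent hub of observation \<open>t\<close> and \<open>G t j \<omega>\<close> says that node \<open>j\<close> belongs to
  the \<open>t\<close>-th observed group. Conditioning on \<open>Z t = i\<close> is only required to make sense when
  \<open>\<rho> i > 0\<close>.
\<close>

locale asymmetric_hub_model = prob_space M
  for M :: "'a measure" +
  fixes nL n T :: nat
    and \<rho> :: "nat \<Rightarrow> real"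
    and A :: "nat \<Rightarrow> nat \<Rightarrow> real"
    and Z :: "nat \<Rightarrow> 'a \<Rightarrow> nat"
    and G :: "nat \<Rightarrow> nat \<Rightarrow> 'a \<Rightarrow> bool"
  assumes nL_le_n: "nL \<le> n"
    and \<rho>_nonneg: "i \<in> {1..nL} \<Longrightarrow> 0 \<le> \<rho> i"
    and \<rho>_sum: "(\<Sum>i\<in>{1..nL}. \<rho> i) = 1"
    and A_unit: "\<lbrakk>i \<in> {1..nL}; j \<in> {1..n}\<rbrakk> \<Longrightarrow> A i j \<in> {0..1}"
    and A_diag: "i \<in> {1..nL} \<Longrightarrow> A i i = 1"
    and Z_range: "\<lbrakk>t \<in> {1..T}; \<omega> \<in> space M\<rbrakk> \<Longrightarrow> Z t \<omega> \<in> {1..nL}"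
    and indep_observations:
      "indep_vars (\<lambda>_. count_space UNIV \<Otimes>\<^sub>M (\<Pi>\<^sub>M j\<in>{1..n}. count_space UNIV))
         (\<lambda>t \<omega>. (Z t \<omega>, \<lambda>j\<in>{1..n}. G t j \<omega>)) {1..T}"
    and Z_prob: "\<lbrakk>t \<in> {1..T}; i \<in> {1..nL}\<rbrakk> \<Longrightarrow> \<P>(\<omega> in M. Z t \<omega> = i) = \<rho> i"
    and G_cond_indep:
      "\<lbrakk>t \<in> {1..T}; i \<in> {1..nL}; \<rho> i > 0\<rbrakk> \<Longrightarrow>
         prob_space.indep_vars (uniform_measure M {\<omega> \<in> space M. Z t \<omega> = i})
           (\<lambda>_. count_space UNIV) (G t) {1..n}"
    and G_cond_prob:
      "\<lbrakk>t \<in> {1..T}; i \<in> {1..nL}; \<rho> i > 0; j \<in> {1..n}\<rbrakk> \<Longrightarrow>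
         \<P>(\<omega> in M. G t j \<omega> \<bar> Z t \<omega> = i) = A i j"

text \<open>
  Below, \<open>g t j\<close> is a realisation of the data and \<open>z\<close> an assignment, of which only the values
  on \<open>{1..T}\<close> matter.
\<close>

definition cluster_size :: "nat \<Rightarrow> (nat \<Rightarrow> nat) \<Rightarrow> nat \<Rightarrow> nat" where
  "cluster_size T z i = card {t \<in> {1..T}. z t = i}"

(* Equals 0 for an empty cluster, since 1 / 0 = 0. *)
definition A_hat ::
  "nat \<Rightarrow> (nat \<Rightarrow> nat \<Rightarrow> bool) \<Rightarrow> (nat \<Rightarrow> nat) \<Rightarrow> nat \<Rightarrow> nat \<Rightarrow> real" where
  "A_hat T g z i j =
     1 / real (cluster_size T z i) * (\<Sum>t\<in>{1..T}. of_bool (g t j) * of_bool (z t = i))"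

(* With ln 0 = 0 the convention 0 log 0 = 0 is respected. A term 1 * log 0 never occurs: observation
   t lies in its own cluster, so A_hat is positive if g t j holds and less than 1 otherwise. *)
definition profile_loglik ::
  "nat \<Rightarrow> nat \<Rightarrow> (nat \<Rightarrow> nat \<Rightarrow> bool) \<Rightarrow> (nat \<Rightarrow> nat) \<Rightarrow> real" where
  "profile_loglik n T g z =
     (\<Sum>t\<in>{1..T}. \<Sum>j\<in>{1..n}.
        of_bool (g t j) * ln (A_hat T g z (z t) j) +
        (1 - of_bool (g t j)) * ln (1 - A_hat T g z (z t) j))"

definition feasible :: "nat \<Rightarrow> nat \<Rightarrow> (nat \<Rightarrow> nat \<Rightarrow> bool) \<Rightarrow> (nat \<Rightarrow> nat) \<Rightarrow> bool" where
  "feasible nL T g z \<longleftrightarrow> (\<forall>t\<in>{1..T}. z t \<in> {1..nL} \<and> g t (z t))"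

definition profile_mle ::
  "nat \<Rightarrow> nat \<Rightarrow> nat \<Rightarrow> (nat \<Rightarrow> nat \<Rightarrow> bool) \<Rightarrow> (nat \<Rightarrow> nat) \<Rightarrow> bool" where
  "profile_mle nL n T g z \<longleftrightarrow> is_arg_max (profile_loglik n T g) (feasible nL T g) z"

text \<open>
  \<open>X k = o\<^sub>p(1)\<close>, where each \<open>X k\<close> lives on its own probability space \<open>M k\<close>. Measurability
  is part of the definition because the measure of a nonmeasurable set is \<open>0\<close> by convention.
\<close>

definition o_p_one :: "(nat \<Rightarrow> 'a measure) \<Rightarrow> (nat \<Rightarrow> 'a \<Rightarrow> real) \<Rightarrow> bool" where
  "o_p_one M X \<longleftrightarrow>
     (\<forall>k. X k \<in> borel_measurable (M k)) \<and>
     (\<forall>\<epsilon>>0. (\<lambda>k. \<P>(\<omega> in M k. \<bar>X k \<omega>\<bar> > \<epsilon>)) \<longlonglongrightarrow> 0)"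

end

theory Submission
  imports Defs
begin

text \<open>
  For fixed \<open>z\<close> and \<open>B\<close>, conditionally on \<open>Z\<close>, the square root of the likelihood ratio of
  \<open>B (z t) j\<close> against the truth \<open>A (Z t) j\<close> has mean equal to a product of Bhattacharyya
  coefficients, each at most \<open>exp (- (B (z t) j - A (Z t) j)\<^sup>2 / 4)\<close>. Now use Markov's
  inequality and a union bound over the at most \<open>nL ^ T\<close> assignments and
  \<open>(T + 1) ^ (2 * n * nL)\<close> possible matrices \<open>A_hat\<close>. Since the maximal profile likelihood is at
  least the likelihood of the truth, the total squared distance between \<open>A_hat (zhat t) j\<close> and
  \<open>A (Z t) j\<close> is \<open>O(T + n log T)\<close>, which is \<open>o(d\<^sup>2 v n T)\<close>.
  An estimated cluster containing a nonnegligible part of two true classes would, by separation,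
  contribute order \<open>d\<^sup>2 v n T\<close>, so \<open>zhat\<close> agrees with \<open>Z\<close> up to a permutation of the labels and
  \<open>o(T)\<close> observations. Feasibility and the bound on \<open>A i i'\<close> force the permutation to be the
  identity, and Hoeffding's inequality for the true classes finishes the proof.
\<close>

section \<open>Bernoulli likelihoods and the Bhattacharyya bound\<close>

definition bern :: "real \<Rightarrow> bool \<Rightarrow> real" where
  "bern p g = (if g then p else 1 - p)"

lemma bern_nonneg: "p \<in> {0..1} \<Longrightarrow> 0 \<le> bern p g"
  by (auto simp: bern_def)

text \<open>The ratio is \<open>0\<close> when \<open>bern p g = 0\<close>, an outcome of probability \<open>0\<close> under \<open>p\<close>.\<close>

definition tilted_root_ratio :: "real \<Rightarrow> real \<Rightarrow> bool \<Rightarrow> real" where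
  "tilted_root_ratio b p g = sqrt (bern b g / bern p g) * exp ((b - p)\<^sup>2 / 4)"

lemma tilted_root_ratio_nonneg:
  "b \<in> {0..1} \<Longrightarrow> p \<in> {0..1} \<Longrightarrow> 0 \<le> tilted_root_ratio b p g"
  unfolding tilted_root_ratio_def by (intro mult_nonneg_nonneg real_sqrt_ge_zero divide_nonneg_nonneg bern_nonneg) auto

text \<open>Factor \<open>b - p\<close> as a difference of squares of the roots; the other factor
  \<open>sqrt b + sqrt p\<close> is at most 2. This passes from Hellinger to Euclidean
  distance.\<close>

lemma sqrt_diff_square_ge:
  fixes b p :: real
  assumes "b \<in> {0..1}" "p \<in> {0..1}"
  shows "(b - p)\<^sup>2 / 4 \<le> (sqrt b - sqrt p)\<^sup>2"
proof -
  have "(b - p)\<^sup>2 = (sqrt b - sqrt p)\<^sup>2 * (sqrt b + sqrt p)\<^sup>2"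
    using assms by (simp add: power_mult_distrib[symmetric] algebra_simps)
  also have "\<dots> \<le> (sqrt b - sqrt p)\<^sup>2 * 2\<^sup>2"
    using assms by (intro mult_left_mono power_mono) (auto intro!: add_mono[of "sqrt b" 1 "sqrt p" 1, simplified])
  finally show ?thesis by simp
qed

text \<open>Averaging the root ratios under \<open>p\<close> gives the Bhattacharyya coefficient,
  that is 1 minus half a sum of two squared root differences. The tilt
  \<open>exp ((b - p)^2 / 4)\<close> is small enough not to lift it above 1.\<close>

lemma mean_tilted_root_ratio_le_1:
  assumes "b \<in> {0..1}" "p \<in> {0..1}"
  shows "p * tilted_root_ratio b p True + (1 - p) * tilted_root_ratio b p False \<le> 1"
proof -
  \<comment> \<open>With \<open>c / 0 = 0\<close> both sides vanish at \<open>q = 0\<close>, so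
    degenerate parameters need no separate treatment.\<close>
  have root: "q * sqrt (c / q) = sqrt c * sqrt q" if "q \<ge> 0" for c q :: real
    using that by (cases "q = 0") (auto simp: real_sqrt_divide field_simps)
  have "sqrt b * sqrt p + sqrt (1 - b) * sqrt (1 - p)
      = 1 - ((sqrt b - sqrt p)\<^sup>2 + (sqrt (1 - b) - sqrt (1 - p))\<^sup>2) / 2"
    using assms by (simp add: power2_diff field_simps)
  also have "\<dots> \<le> 1 - (b - p)\<^sup>2 / 4"
    using sqrt_diff_square_ge[of b p] sqrt_diff_square_ge[of "1 - b" "1 - p"] assms
    by (simp add: power2_commute)
  also have "\<dots> \<le> exp (- ((b - p)\<^sup>2 / 4))"
    using exp_ge_add_one_self[of "- ((b - p)\<^sup>2 / 4)"] by simp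
  finally have "(sqrt b * sqrt p + sqrt (1 - b) * sqrt (1 - p)) * exp ((b - p)\<^sup>2 / 4)
      \<le> exp (- ((b - p)\<^sup>2 / 4)) * exp ((b - p)\<^sup>2 / 4)"
    by (intro mult_right_mono) auto
  also have "\<dots> = 1" by (simp flip: exp_add)
  finally show ?thesis
    using root[of p b] root[of "1 - p" "1 - b"] assms
    by (simp add: tilted_root_ratio_def bern_def distrib_right mult.assoc[symmetric])
qed

section \<open>Integration over the hub, and Markov's inequality for one fixed candidate\<close>

context asymmetric_hub_model
begin

lemma measurable_observation:
  "t \<in> {1..T} \<Longrightarrow> (\<lambda>\<omega>. (Z t \<omega>, \<lambda>j\<in>{1..n}. G t j \<omega>))
     \<in> measurable M (count_space UNIV \<Otimes>\<^sub>M (\<Pi>\<^sub>M j\<in>{1..n}. count_space UNIV))"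
  using indep_observations by (auto simp: indep_vars_def)

lemma measurable_Z [measurable]: "t \<in> {1..T} \<Longrightarrow> Z t \<in> measurable M (count_space UNIV)"
  using measurable_compose[OF measurable_observation measurable_fst] by simp

lemma measurable_G [measurable]:
  assumes "t \<in> {1..T}" "j \<in> {1..n}"
  shows "G t j \<in> measurable M (count_space UNIV)"
  using measurable_compose[OF measurable_compose[OF measurable_observation[OF assms(1)]
      measurable_snd] measurable_component_singleton[OF assms(2)]] assms by simp

text \<open>Split over the hub; on each event \<open>Z t = i\<close> conditional independence
  factorises the integral. \<open>F\<close> may depend on the hub so that the true parameter
  \<open>A (Z t) j\<close> can occur in the integrand, and values in \<open>ennreal\<close> avoid
  integrability conditions.\<close>

lemma nn_integral_observation:
  fixes F :: "nat \<Rightarrow> nat \<Rightarrow> bool \<Rightarrow> ennreal"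
  assumes t: "t \<in> {1..T}" and \<rho>_pos: "\<And>i. i \<in> {1..nL} \<Longrightarrow> \<rho> i > 0"
  shows "(\<integral>\<^sup>+\<omega>. (\<Prod>j\<in>{1..n}. F (Z t \<omega>) j (G t j \<omega>)) \<partial>M)
     = (\<Sum>i\<in>{1..nL}. ennreal (\<rho> i) *
          (\<Prod>j\<in>{1..n}. ennreal (A i j) * F i j True + ennreal (1 - A i j) * F i j False))"
proof -
  note [measurable] = measurable_Z[OF t] measurable_G[OF t]
  define S where "S i = {\<omega>\<in>space M. Z t \<omega> = i}" for i
  have S [measurable]: "S i \<in> sets M" for i
    unfolding S_def by measurable
  have "(\<integral>\<^sup>+\<omega>. (\<Prod>j\<in>{1..n}. F (Z t \<omega>) j (G t j \<omega>)) \<partial>M)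
      = (\<integral>\<^sup>+\<omega>. (\<Sum>i\<in>{1..nL}. (\<Prod>j\<in>{1..n}. F i j (G t j \<omega>)) * indicator (S i) \<omega>) \<partial>M)"
  proof (rule nn_integral_cong)
    fix \<omega> assume w: "\<omega> \<in> space M"
    have "(\<Sum>i\<in>{1..nL}. (\<Prod>j\<in>{1..n}. F i j (G t j \<omega>)) * indicator (S i) \<omega>)
       = (\<Sum>i\<in>{1..nL}. if i = Z t \<omega> then \<Prod>j\<in>{1..n}. F i j (G t j \<omega>) else 0)"
      using w by (intro sum.cong) (auto simp: S_def)
    then show "(\<Prod>j\<in>{1..n}. F (Z t \<omega>) j (G t j \<omega>))
      = (\<Sum>i\<in>{1..nL}. (\<Prod>j\<in>{1..n}. F i j (G t j \<omega>)) * indicator (S i) \<omega>)"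
      using Z_range[OF t w] by simp
  qed
  also have "\<dots> = (\<Sum>i\<in>{1..nL}. \<integral>\<^sup>+\<omega>. (\<Prod>j\<in>{1..n}. F i j (G t j \<omega>)) * indicator (S i) \<omega> \<partial>M)"
    by (intro nn_integral_sum) measurable
  also have "\<dots> = (\<Sum>i\<in>{1..nL}. ennreal (\<rho> i) *
          (\<Prod>j\<in>{1..n}. ennreal (A i j) * F i j True + ennreal (1 - A i j) * F i j False))"
  proof (intro sum.cong refl)
    fix i assume i: "i \<in> {1..nL}"
    have em: "emeasure M (S i) = ennreal (\<rho> i)"
      using Z_prob[OF t i] by (simp add: S_def emeasure_eq_measure)
    define U where "U = uniform_measure M (S i)"
    interpret U: prob_space U
      unfolding U_def using em \<rho>_pos[OF i] by (intro prob_space_uniform_measure) auto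
    have sets_U [measurable_cong]: "sets U = sets M" and space_U: "space U = space M"
      by (simp_all add: U_def)
    have "(\<integral>\<^sup>+\<omega>. (\<Prod>j\<in>{1..n}. F i j (G t j \<omega>)) * indicator (S i) \<omega> \<partial>M)
        = ennreal (\<rho> i) * (\<integral>\<^sup>+\<omega>. (\<Prod>j\<in>{1..n}. F i j (G t j \<omega>)) \<partial>U)"
      unfolding U_def using \<rho>_pos[OF i]
      by (subst nn_integral_uniform_measure)
         (auto simp: em ennreal_times_divide ennreal_mult_divide_eq mult.commute[of "ennreal (\<rho> i)"]
            simp del: prod.cl_ivl_Suc)
    also have "(\<integral>\<^sup>+\<omega>. (\<Prod>j\<in>{1..n}. F i j (G t j \<omega>)) \<partial>U)
       = (\<Prod>j\<in>{1..n}. \<integral>\<^sup>+\<omega>. F i j (G t j \<omega>) \<partial>U)"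
    proof (rule U.indep_vars_nn_integral)
      show "U.indep_vars (\<lambda>_. borel) (\<lambda>j \<omega>. F i j (G t j \<omega>)) {1..n}"
        using U.indep_vars_compose2[OF G_cond_indep[OF t i \<rho>_pos[OF i], folded S_def U_def],
            of "\<lambda>j. F i j" "\<lambda>_. borel"] by simp
    qed auto
    also have "\<dots> = (\<Prod>j\<in>{1..n}. ennreal (A i j) * F i j True + ennreal (1 - A i j) * F i j False)"
    proof (intro prod.cong refl)
      fix j assume j: "j \<in> {1..n}"
      note [measurable] = measurable_G[OF t j]
      have GT: "emeasure U {\<omega>\<in>space U. G t j \<omega>} = ennreal (A i j)"
        using G_cond_prob[OF t i \<rho>_pos[OF i] j]
          measure_uniform_measure_eq_cond_prob[of "G t j" "\<lambda>\<omega>. Z t \<omega> = i"]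
        unfolding U.emeasure_eq_measure by (simp add: U_def S_def)
      have "emeasure U {\<omega>\<in>space U. \<not> G t j \<omega>} = 1 - ennreal (A i j)"
        using emeasure_compl[of "{\<omega>\<in>space U. G t j \<omega>}" U] GT
        by (simp add: U.emeasure_space_1 set_diff_eq cong: conj_cong)
      also have "\<dots> = ennreal (1 - A i j)"
        using A_unit[OF i j] by (simp add: ennreal_minus flip: ennreal_1)
      finally have GF: "emeasure U {\<omega>\<in>space U. \<not> G t j \<omega>} = ennreal (1 - A i j)" .
      have "(\<integral>\<^sup>+\<omega>. F i j (G t j \<omega>) \<partial>U) = (\<integral>\<^sup>+\<omega>. F i j True * indicator {\<omega>\<in>space U. G t j \<omega>} \<omega>
          + F i j False * indicator {\<omega>\<in>space U. \<not> G t j \<omega>} \<omega> \<partial>U)"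
        by (intro nn_integral_cong) (auto split: split_indicator)
      also have "\<dots> = F i j True * ennreal (A i j) + F i j False * ennreal (1 - A i j)"
        by (subst nn_integral_add) (auto simp: nn_integral_cmult GT GF)
      finally show "(\<integral>\<^sup>+\<omega>. F i j (G t j \<omega>) \<partial>U)
         = ennreal (A i j) * F i j True + ennreal (1 - A i j) * F i j False"
        by (simp add: mult.commute)
    qed
    finally show "(\<integral>\<^sup>+\<omega>. (\<Prod>j\<in>{1..n}. F i j (G t j \<omega>)) * indicator (S i) \<omega> \<partial>M)
        = ennreal (\<rho> i) * (\<Prod>j\<in>{1..n}. ennreal (A i j) * F i j True + ennreal (1 - A i j) * F i j False)" .
  qed
  finally show ?thesis .
qed

text \<open>For nonrandom \<open>b\<close> the factors over \<open>t\<close> are independent with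
  mean at most 1, so their product has mean at most 1 and Markov's inequality applies at level
  \<open>exp x\<close>. Data-dependent candidates enter later through a union bound.\<close>

lemma prob_tilted_likelihood_ratio:
  assumes \<rho>_pos: "\<And>i. i \<in> {1..nL} \<Longrightarrow> \<rho> i > 0"
    and b: "\<And>t j. t \<in> {1..T} \<Longrightarrow> j \<in> {1..n} \<Longrightarrow> b t j \<in> {0..1}"
  shows "{\<omega>\<in>space M. exp x \<le> (\<Prod>t\<in>{1..T}. \<Prod>j\<in>{1..n}.
            tilted_root_ratio (b t j) (A (Z t \<omega>) j) (G t j \<omega>))} \<in> events" (is "?E \<in> _")
    and "prob {\<omega>\<in>space M. exp x \<le> (\<Prod>t\<in>{1..T}. \<Prod>j\<in>{1..n}.
            tilted_root_ratio (b t j) (A (Z t \<omega>) j) (G t j \<omega>))} \<le> exp (- x)"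
proof -
  define W where "W t \<omega> = (\<Prod>j\<in>{1..n}. tilted_root_ratio (b t j) (A (Z t \<omega>) j) (G t j \<omega>))" for t \<omega>
  have W_measurable [measurable]: "W t \<in> borel_measurable M" if t: "t \<in> {1..T}" for t
  proof -
    note [measurable] = measurable_Z[OF t] measurable_G[OF t]
    have [measurable]: "(\<lambda>\<omega>. A (Z t \<omega>) j) \<in> borel_measurable M" for j
      by (rule measurable_compose[OF measurable_Z[OF t]]) simp
    show ?thesis unfolding W_def tilted_root_ratio_def bern_def by measurable
  qed
  have W_nonneg: "0 \<le> W t \<omega>" if "t \<in> {1..T}" "\<omega> \<in> space M" for t \<omega>
    unfolding W_def using that b A_unit Z_range by (intro prod_nonneg tilted_root_ratio_nonneg) blast+
  have W_mean: "(\<integral>\<^sup>+\<omega>. ennreal (W t \<omega>) \<partial>M) \<le> 1" if t: "t \<in> {1..T}" for t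
  proof -
    have "(\<integral>\<^sup>+\<omega>. ennreal (W t \<omega>) \<partial>M)
      = (\<integral>\<^sup>+\<omega>. (\<Prod>j\<in>{1..n}. ennreal (tilted_root_ratio (b t j) (A (Z t \<omega>) j) (G t j \<omega>))) \<partial>M)"
      unfolding W_def using t b A_unit Z_range
      by (intro nn_integral_cong prod_ennreal[symmetric] tilted_root_ratio_nonneg) blast+
    also have "\<dots> = (\<Sum>i\<in>{1..nL}. ennreal (\<rho> i) * (\<Prod>j\<in>{1..n}.
        ennreal (A i j) * ennreal (tilted_root_ratio (b t j) (A i j) True) +
        ennreal (1 - A i j) * ennreal (tilted_root_ratio (b t j) (A i j) False)))"
      by (rule nn_integral_observation[OF t \<rho>_pos])
    also have "\<dots> \<le> (\<Sum>i\<in>{1..nL}. ennreal (\<rho> i) * (\<Prod>j\<in>{1..n}. 1))"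
    proof -
      have "ennreal (A i j) * ennreal (tilted_root_ratio (b t j) (A i j) True) +
        ennreal (1 - A i j) * ennreal (tilted_root_ratio (b t j) (A i j) False) \<le> 1"
        if ij: "i \<in> {1..nL}" "j \<in> {1..n}" for i j
      proof -
      have "ennreal (A i j) * ennreal (tilted_root_ratio (b t j) (A i j) True) +
        ennreal (1 - A i j) * ennreal (tilted_root_ratio (b t j) (A i j) False)
        = ennreal (A i j * tilted_root_ratio (b t j) (A i j) True +
           (1 - A i j) * tilted_root_ratio (b t j) (A i j) False)"
        using A_unit[OF ij] b[OF t ij(2)]
        by (simp add: ennreal_plus ennreal_mult tilted_root_ratio_nonneg)
      also have "\<dots> \<le> 1"
        using mean_tilted_root_ratio_le_1[OF b[OF t ij(2)] A_unit[OF ij]] by simp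
      finally show ?thesis .
      qed
      then show ?thesis
        by (intro sum_mono mult_left_mono prod_mono_ennreal) auto
    qed
    also have "\<dots> = ennreal (\<Sum>i\<in>{1..nL}. \<rho> i)"
      by (subst sum_ennreal[symmetric]) (use \<rho>_nonneg in auto)
    finally show ?thesis using \<rho>_sum by simp
  qed
  have "indep_vars (\<lambda>_. borel) (\<lambda>t \<omega>. ennreal (W t \<omega>)) {1..T}"
  proof -
    let ?N = "count_space UNIV \<Otimes>\<^sub>M (\<Pi>\<^sub>M j\<in>{1..n}. count_space UNIV) :: (nat \<times> (nat \<Rightarrow> bool)) measure"
    \<comment> \<open>Independence is given for whole observations, so \<open>W t\<close> is
      expressed through the pair of hub and group. The hub is countable, so measurability can be
      checked for one hub at a time.\<close>
    define Y where "Y t = (\<lambda>(i, g). ennreal (\<Prod>j\<in>{1..n}. tilted_root_ratio (b t j) (A i j) (g j)))" for t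
    have "Y t \<in> borel_measurable ?N" for t
      unfolding Y_def
    proof (rule measurable_pair_measure_countable1)
      fix i :: nat
      have "(\<lambda>g. tilted_root_ratio (b t j) (A i j) (g j))
          \<in> borel_measurable (\<Pi>\<^sub>M j\<in>{1..n}. count_space UNIV)" if "j \<in> {1..n}" for j
        by (rule measurable_compose[OF measurable_component_singleton[OF that]]) simp
      then show "(\<lambda>y. case (i, y) of (i, g) \<Rightarrow>
          ennreal (\<Prod>j\<in>{1..n}. tilted_root_ratio (b t j) (A i j) (g j)))
          \<in> borel_measurable (\<Pi>\<^sub>M j\<in>{1..n}. count_space UNIV)"
        unfolding prod.case by (intro measurable_compose[OF _ measurable_ennreal] borel_measurable_prod)
    qed auto
    then have "indep_vars (\<lambda>_. borel) (\<lambda>t \<omega>. Y t (Z t \<omega>, \<lambda>j\<in>{1..n}. G t j \<omega>)) {1..T}"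
      by (rule indep_vars_compose2[OF indep_observations])
    then show ?thesis by (simp add: Y_def W_def cong: prod.cong_simp)
  qed
  then have "(\<integral>\<^sup>+\<omega>. (\<Prod>t\<in>{1..T}. ennreal (W t \<omega>)) \<partial>M) = (\<Prod>t\<in>{1..T}. \<integral>\<^sup>+\<omega>. ennreal (W t \<omega>) \<partial>M)"
    by (intro indep_vars_nn_integral) auto
  also have "\<dots> \<le> (\<Prod>t\<in>{1..T}. 1)"
    by (intro prod_mono_ennreal W_mean) auto
  finally have mean: "(\<integral>\<^sup>+\<omega>. (\<Prod>t\<in>{1..T}. ennreal (W t \<omega>)) \<partial>M) \<le> 1" by simp
  have E_eq: "?E = {\<omega>\<in>space M. exp x \<le> (\<Prod>t\<in>{1..T}. W t \<omega>)}"
    by (simp add: W_def)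
  show "?E \<in> events"
    unfolding E_eq by measurable
  have "emeasure M ?E \<le> emeasure M {\<omega>\<in>space M. 1 \<le> ennreal (exp (- x)) * (\<Prod>t\<in>{1..T}. ennreal (W t \<omega>))}"
  proof (rule emeasure_mono)
    show "?E \<subseteq> {\<omega>\<in>space M. 1 \<le> ennreal (exp (- x)) * (\<Prod>t\<in>{1..T}. ennreal (W t \<omega>))}"
      unfolding E_eq
    proof (intro Collect_mono impI conjI; elim conjE)
      fix \<omega> assume w: "\<omega> \<in> space M" and le: "exp x \<le> (\<Prod>t\<in>{1..T}. W t \<omega>)"
      have "ennreal (exp (- x)) * (\<Prod>t\<in>{1..T}. ennreal (W t \<omega>))
         = ennreal (exp (- x) * (\<Prod>t\<in>{1..T}. W t \<omega>))"
        using w W_nonneg by (subst prod_ennreal) (auto simp: ennreal_mult')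
      moreover have "1 \<le> exp (- x) * (\<Prod>t\<in>{1..T}. W t \<omega>)"
        using mult_left_mono[OF le, of "exp (- x)"] by (simp flip: exp_add)
      ultimately show "1 \<le> ennreal (exp (- x)) * (\<Prod>t\<in>{1..T}. ennreal (W t \<omega>))" by simp
    qed
  qed measurable
  also have "\<dots> \<le> ennreal (exp (- x)) * (\<integral>\<^sup>+\<omega>. (\<Prod>t\<in>{1..T}. ennreal (W t \<omega>)) * indicator (space M) \<omega> \<partial>M)"
    by (rule nn_integral_Markov_inequality) measurable
  also have "\<dots> = ennreal (exp (- x)) * (\<integral>\<^sup>+\<omega>. (\<Prod>t\<in>{1..T}. ennreal (W t \<omega>)) \<partial>M)"
    by (intro arg_cong2[where f="(*)"] refl nn_integral_cong) simp
  also have "\<dots> \<le> ennreal (exp (- x))"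
    using mult_left_mono[OF mean, of "ennreal (exp (- x))"] by simp
  finally show "prob ?E \<le> exp (- x)"
    by (simp add: emeasure_eq_measure)
qed

end

section \<open>Deterministic comparison of likelihoods\<close>

lemma sqrt_prod: "sqrt (prod f S) = (\<Prod>x\<in>S. sqrt (f x))"
  by (induction S rule: infinite_finite_induct) (auto simp: real_sqrt_mult)

lemma A_hat_eq_card:
  "A_hat T g z i j = real (card {t\<in>{1..T}. z t = i \<and> g t j}) / real (card {t\<in>{1..T}. z t = i})"
proof -
  have "(\<Sum>t\<in>{1..T}. of_bool (g t j) * of_bool (z t = i)) = real (card {t\<in>{1..T}. z t = i \<and> g t j})"
    by (subst card_eq_sum, subst of_nat_sum, rule sum.mono_neutral_cong_right) auto
  then show ?thesis
    by (simp add: A_hat_def cluster_size_def)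
qed

lemma A_hat_unit: "A_hat T g z i j \<in> {0..1}"
proof -
  have "card {t\<in>{1..T}. z t = i \<and> g t j} \<le> card {t\<in>{1..T}. z t = i}"
    by (intro card_mono) auto
  then show ?thesis
    unfolding A_hat_eq_card by (simp add: divide_le_eq)
qed

text \<open>Observation \<open>t\<close> counts in its own cluster, so the frequency is neither 0
  when \<open>g t j\<close> holds nor 1 when it fails. This justifies dividing by these factors and
  taking their logarithms.\<close>

lemma bern_A_hat_pos:
  assumes "t \<in> {1..T}"
  shows "0 < bern (A_hat T g z (z t) j) (g t j)"
proof -
  let ?C = "{s\<in>{1..T}. z s = z t}" and ?P = "{s\<in>{1..T}. z s = z t \<and> g s j}"
  have C: "card ?C > 0" using assms by (auto simp: card_gt_0_iff)
  show ?thesis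
  proof (cases "g t j")
    case True
    then have "t \<in> ?P" using assms by simp
    then have "card ?P > 0" by (subst card_gt_0_iff) auto
    then show ?thesis using C True unfolding bern_def A_hat_eq_card by simp
  next
    case False
    have "t \<in> ?C" "t \<notin> ?P" using assms False by auto
    then have "card ?P < card ?C" by (intro psubset_card_mono psubsetI) (simp, blast, blast)
    then show ?thesis using C False unfolding bern_def A_hat_eq_card by simp
  qed
qed

text \<open>With \<open>a\<close> members containing \<open>j\<close> in a cluster of size
  \<open>s\<close>, those members contribute \<open>b * s\<close> in total and the others
  \<open>(1 - b) * s\<close>. Only an empty group of members makes the sum smaller than
  \<open>s\<close>.\<close>

lemma sum_bern_ratio_cluster_le:
  assumes b: "b \<in> {0..1}"
  shows "(\<Sum>t | t \<in> {1..T} \<and> z t = i. bern b (g t j) / bern (A_hat T g z i j) (g t j))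
     \<le> real (card {t\<in>{1..T}. z t = i})"
proof -
  let ?C = "{t\<in>{1..T}. z t = i}"
  let ?P = "{t\<in>{1..T}. z t = i \<and> g t j}" and ?N = "{t\<in>{1..T}. z t = i \<and> \<not> g t j}"
  define s a c where "s = real (card ?C)" and "a = real (card ?P)" and "c = real (card ?N)"
  have C: "?C = ?P \<union> ?N" by auto
  have sac: "s = a + c"
  proof -
    have "card ?C = card ?P + card ?N"
      unfolding C by (rule card_Un_disjoint) auto
    then show ?thesis by (simp add: s_def a_def c_def)
  qed
  have nonneg: "a \<ge> 0" "c \<ge> 0" by (auto simp: a_def c_def)
  have A: "A_hat T g z i j = a / s"
    unfolding A_hat_eq_card a_def s_def ..
  have "(\<Sum>t\<in>?C. bern b (g t j) / bern (A_hat T g z i j) (g t j))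
    = (\<Sum>t\<in>?P. bern b (g t j) / bern (A_hat T g z i j) (g t j))
    + (\<Sum>t\<in>?N. bern b (g t j) / bern (A_hat T g z i j) (g t j))"
    unfolding C by (rule sum.union_disjoint) auto
  also have "\<dots> = (\<Sum>t\<in>?P. b / (a / s)) + (\<Sum>t\<in>?N. (1 - b) / (1 - a / s))"
    by (intro arg_cong2[where f="(+)"] sum.cong) (auto simp: bern_def A)
  also have "\<dots> = a * (b / (a / s)) + c * ((1 - b) / (1 - a / s))"
    by (simp add: a_def c_def)
  also have "a * (b / (a / s)) \<le> b * s"
    using nonneg b sac by (cases "a = 0") auto
  also have "c * ((1 - b) / (1 - a / s)) \<le> (1 - b) * s"
  proof (cases "c = 0")
    case False
    then have "1 - a / s = c / s" using sac nonneg by (auto simp: field_simps)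
    then show ?thesis using False by simp
  qed (use b sac nonneg in auto)
  finally show ?thesis by (simp add: s_def algebra_simps)
qed

text \<open>A multiplicative Gibbs inequality: for each node the ratios \<open>r t j\<close> sum to
  at most \<open>T\<close>, and \<open>r \<le> exp (r - 1)\<close> turns this into a product of at
  most 1. Without logarithms, a vanishing likelihood on the left is harmless. \<open>B\<close>
  depends on \<open>t\<close> only through the cluster, which is why the cluster frequencies
  dominate it.\<close>

lemma likelihood_le_profile_likelihood:
  assumes B: "\<And>t j. t \<in> {1..T} \<Longrightarrow> j \<in> J \<Longrightarrow> B (z t) j \<in> {0..1}"
  shows "(\<Prod>t\<in>{1..T}. \<Prod>j\<in>J. bern (B (z t) j) (g t j))
     \<le> (\<Prod>t\<in>{1..T}. \<Prod>j\<in>J. bern (A_hat T g z (z t) j) (g t j))"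
proof -
  define r where "r t j = bern (B (z t) j) (g t j) / bern (A_hat T g z (z t) j) (g t j)" for t j
  have r_nonneg: "0 \<le> r t j" if "t \<in> {1..T}" "j \<in> J" for t j
    using bern_nonneg[OF B[OF that]] bern_A_hat_pos[OF that(1), of g z j] by (simp add: r_def)
  have r_sum: "(\<Sum>t\<in>{1..T}. r t j) \<le> real T" if j: "j \<in> J" for j
  proof -
    have "(\<Sum>t\<in>{1..T}. r t j) = (\<Sum>i\<in>z ` {1..T}. \<Sum>t\<in>{t\<in>{1..T}. z t = i}. r t j)"
      by (rule sum.image_gen) simp
    also have "\<dots> \<le> (\<Sum>i\<in>z ` {1..T}. real (card {t\<in>{1..T}. z t = i}))"
    proof (rule sum_mono)
      fix i assume "i \<in> z ` {1..T}"
      then have "B i j \<in> {0..1}" using B j by auto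
      from sum_bern_ratio_cluster_le[OF this, where T=T and z=z and i=i and g=g and j=j]
      show "(\<Sum>t\<in>{t\<in>{1..T}. z t = i}. r t j) \<le> real (card {t\<in>{1..T}. z t = i})"
        unfolding r_def by (smt (verit) mem_Collect_eq sum.cong)
    qed
    also have "\<dots> = (\<Sum>i\<in>z ` {1..T}. \<Sum>t\<in>{t\<in>{1..T}. z t = i}. 1)" by simp
    also have "\<dots> = (\<Sum>t\<in>{1..T}. 1)"
      by (rule sum.image_gen[symmetric]) simp
    finally show ?thesis by simp
  qed
  have "(\<Prod>t\<in>{1..T}. \<Prod>j\<in>J. r t j) \<le> (\<Prod>t\<in>{1..T}. \<Prod>j\<in>J. exp (r t j - 1))"
    using exp_ge_add_one_self[of "r t j - 1" for t j] r_nonneg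
    by (intro prod_mono conjI prod_nonneg) auto
  also have "\<dots> = (\<Prod>j\<in>J. \<Prod>t\<in>{1..T}. exp (r t j - 1))"
    by (rule prod.swap)
  also have "\<dots> = (\<Prod>j\<in>J. exp (\<Sum>t\<in>{1..T}. r t j - 1))"
    by (simp add: exp_sum)
  also have "\<dots> \<le> 1"
    using r_sum by (intro prod_le_1) (auto simp: sum_subtractf)
  finally have "(\<Prod>t\<in>{1..T}. \<Prod>j\<in>J. bern (B (z t) j) (g t j))
     / (\<Prod>t\<in>{1..T}. \<Prod>j\<in>J. bern (A_hat T g z (z t) j) (g t j)) \<le> 1"
    by (simp add: r_def prod_dividef)
  moreover have "0 < (\<Prod>t\<in>{1..T}. \<Prod>j\<in>J. bern (A_hat T g z (z t) j) (g t j))"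
    using bern_A_hat_pos by (intro prod_pos) blast
  ultimately show ?thesis by simp
qed

lemma exp_profile_loglik:
  "exp (profile_loglik n T g z) = (\<Prod>t\<in>{1..T}. \<Prod>j\<in>{1..n}. bern (A_hat T g z (z t) j) (g t j))"
proof -
  have eq: "profile_loglik n T g z
     = (\<Sum>t\<in>{1..T}. \<Sum>j\<in>{1..n}. ln (bern (A_hat T g z (z t) j) (g t j)))"
    unfolding profile_loglik_def by (intro sum.cong refl) (auto simp: bern_def)
  show ?thesis
    unfolding eq exp_sum[OF finite_atLeastAtMost]
    by (intro prod.cong refl exp_ln bern_A_hat_pos)
qed

text \<open>The truth \<open>z0\<close> is a competitor: its likelihood \<open>P\<close> is at most
  its profile likelihood, hence at most the maximum \<open>Q\<close>. So the root ratios multiply to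
  at least 1, and the tilts multiply to the exponential on the left. \<open>pos\<close> ensures
  \<open>P > 0\<close>.\<close>

lemma exp_distance_le_tilted_ratio_of_mle:
  assumes mle: "profile_mle nL n T g z"
    and feas: "feasible nL T g z0"
    and A: "\<And>i j. i \<in> {1..nL} \<Longrightarrow> j \<in> {1..n} \<Longrightarrow> A i j \<in> {0..1}"
    and pos: "\<And>t j. t \<in> {1..T} \<Longrightarrow> j \<in> {1..n} \<Longrightarrow> 0 < bern (A (z0 t) j) (g t j)"
  shows "exp ((\<Sum>t\<in>{1..T}. \<Sum>j\<in>{1..n}. (A_hat T g z (z t) j - A (z0 t) j)\<^sup>2) / 4)
    \<le> (\<Prod>t\<in>{1..T}. \<Prod>j\<in>{1..n}. tilted_root_ratio (A_hat T g z (z t) j) (A (z0 t) j) (g t j))"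
proof -
  define P where "P = (\<Prod>t\<in>{1..T}. \<Prod>j\<in>{1..n}. bern (A (z0 t) j) (g t j))"
  define Q where "Q = (\<Prod>t\<in>{1..T}. \<Prod>j\<in>{1..n}. bern (A_hat T g z (z t) j) (g t j))"
  define D where "D = (\<Sum>t\<in>{1..T}. \<Sum>j\<in>{1..n}. (A_hat T g z (z t) j - A (z0 t) j)\<^sup>2)"
  have "P \<le> exp (profile_loglik n T g z0)"
    unfolding P_def exp_profile_loglik using feas A
    by (intro likelihood_le_profile_likelihood) (auto simp: feasible_def)
  also have "\<dots> \<le> exp (profile_loglik n T g z)"
    using mle feas by (auto simp: profile_mle_def is_arg_max_def not_less)
  also have "\<dots> = Q"
    by (simp add: exp_profile_loglik Q_def)
  finally have "P \<le> Q" .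
  moreover have "P > 0" unfolding P_def using pos by (intro prod_pos) blast
  ultimately have "1 \<le> sqrt (Q / P)" by simp
  then have "exp (D / 4) \<le> sqrt (Q / P) * exp (D / 4)" by simp
  also have "\<dots> = (\<Prod>t\<in>{1..T}. \<Prod>j\<in>{1..n}. tilted_root_ratio (A_hat T g z (z t) j) (A (z0 t) j) (g t j))"
    unfolding tilted_root_ratio_def Q_def P_def D_def prod.distrib sum_divide_distrib
      exp_sum[OF finite_atLeastAtMost] sqrt_prod[symmetric] prod_dividef ..
  finally show ?thesis unfolding D_def .
qed

section \<open>Union bound over assignments and candidate matrices\<close>

text \<open>A finite set containing every value of \<open>A_hat\<close>; denominator 0 accounts for
  empty clusters. Intersecting with \<open>{0..1}\<close> makes each element an admissible Bernoulli
  parameter.\<close>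

definition fractions :: "nat \<Rightarrow> real set" where
  "fractions T = (\<lambda>(a, b). real a / real b) ` ({0..T} \<times> {0..T}) \<inter> {0..1}"

lemma finite_fractions: "finite (fractions T)"
  by (simp add: fractions_def)

lemma card_fractions_le: "card (fractions T) \<le> (T + 1)\<^sup>2"
proof -
  have "card (fractions T) \<le> card ((\<lambda>(a, b). real a / real b) ` ({0..T} \<times> {0..T}))"
    unfolding fractions_def by (intro card_mono) auto
  also have "\<dots> \<le> card ({0..T} \<times> {0..T})"
    by (intro card_image_le) auto
  also have "\<dots> = (T + 1)\<^sup>2" by (simp add: power2_eq_square)
  finally show ?thesis .
qed

lemma A_hat_in_fractions: "A_hat T g z i j \<in> fractions T"
proof -
  have "card {t\<in>{1..T}. P t} \<le> T" for P
    using card_mono[of "{1..T}" "{t\<in>{1..T}. P t}"] by fastforce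
  then show ?thesis
    using A_hat_unit[of T g z i j] unfolding fractions_def A_hat_eq_card
    by (intro IntI image_eqI[where x="(card {t\<in>{1..T}. z t = i \<and> g t j}, card {t\<in>{1..T}. z t = i})"]) auto
qed

context asymmetric_hub_model
begin

text \<open>Outcomes with \<open>bern\<close> equal to 0 have conditional probability 0, so
  inserting the indicator of positivity into the integral formula leaves the total mass at
  1.\<close>

lemma AE_bern_pos:
  assumes \<rho>_pos: "\<And>i. i \<in> {1..nL} \<Longrightarrow> \<rho> i > 0"
  shows "AE \<omega> in M. \<forall>t\<in>{1..T}. \<forall>j\<in>{1..n}. 0 < bern (A (Z t \<omega>) j) (G t j \<omega>)"
proof (rule AE_finite_allI)
  fix t assume t: "t \<in> {1..T}"
  note [measurable] = measurable_Z[OF t] measurable_G[OF t]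
  have [measurable]: "(\<lambda>\<omega>. A (Z t \<omega>) j) \<in> borel_measurable M" for j
    by (rule measurable_compose[OF measurable_Z[OF t]]) simp
  define E where "E = {\<omega>\<in>space M. \<forall>j\<in>{1..n}. 0 < bern (A (Z t \<omega>) j) (G t j \<omega>)}"
  have E [measurable]: "E \<in> events"
    unfolding E_def bern_def by measurable
  have "emeasure M E = (\<integral>\<^sup>+\<omega>. (\<Prod>j\<in>{1..n}. of_bool (0 < bern (A (Z t \<omega>) j) (G t j \<omega>))) \<partial>M)"
    unfolding nn_integral_indicator[OF E, symmetric]
    by (intro nn_integral_cong) (auto simp: E_def indicator_def prod_zero_iff)
  also have "\<dots> = (\<Sum>i\<in>{1..nL}. ennreal (\<rho> i) * (\<Prod>j\<in>{1..n}.
      ennreal (A i j) * of_bool (0 < bern (A i j) True)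
      + ennreal (1 - A i j) * of_bool (0 < bern (A i j) False)))"
    by (rule nn_integral_observation[OF t \<rho>_pos])
  also have "\<dots> = (\<Sum>i\<in>{1..nL}. ennreal (\<rho> i) * (\<Prod>j\<in>{1..n}. 1))"
  proof (intro sum.cong prod.cong refl arg_cong2[where f="(*)"])
    fix i j assume ij: "i \<in> {1..nL}" "j \<in> {1..n}"
    have "ennreal (A i j) * of_bool (0 < bern (A i j) True)
      + ennreal (1 - A i j) * of_bool (0 < bern (A i j) False) = ennreal (A i j) + ennreal (1 - A i j)"
      using A_unit[OF ij] by (auto simp: bern_def)
    also have "\<dots> = 1"
      using A_unit[OF ij] by (simp flip: ennreal_plus)
    finally show "ennreal (A i j) * of_bool (0 < bern (A i j) True)
      + ennreal (1 - A i j) * of_bool (0 < bern (A i j) False) = 1" .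
  qed
  also have "\<dots> = ennreal (\<Sum>i\<in>{1..nL}. \<rho> i)"
    by (subst sum_ennreal[symmetric]) (use \<rho>_nonneg in auto)
  finally have "prob E = 1"
    using \<rho>_sum by (simp add: emeasure_eq_measure)
  then show "AE \<omega> in M. \<forall>j\<in>{1..n}. 0 < bern (A (Z t \<omega>) j) (G t j \<omega>)"
    by (auto dest: AE_prob_1 simp: E_def)
qed simp

text \<open>In the hub's own column the parameter is 1, so a positive factor forces the hub into its
  group. This admits the true labels as a competitor of the maximizer.\<close>

lemma feasible_Z:
  assumes "\<omega> \<in> space M"
    and "\<forall>t\<in>{1..T}. \<forall>j\<in>{1..n}. 0 < bern (A (Z t \<omega>) j) (G t j \<omega>)"
  shows "feasible nL T (\<lambda>t j. G t j \<omega>) (\<lambda>t. Z t \<omega>)"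
  unfolding feasible_def
proof (intro ballI conjI)
  fix t assume t: "t \<in> {1..T}"
  show Z: "Z t \<omega> \<in> {1..nL}" by (rule Z_range[OF t assms(1)])
  with nL_le_n have "Z t \<omega> \<in> {1..n}" by auto
  with assms(2) t have "0 < bern (A (Z t \<omega>) (Z t \<omega>)) (G t (Z t \<omega>) \<omega>)" by blast
  then show "G t (Z t \<omega>) \<omega>" using A_diag[OF Z] by (simp add: bern_def split: if_splits)
qed

text \<open>The maximizer and its frequencies are random, so the bound for fixed candidates is
  summed over all of them; each of the \<open>n * nL\<close> matrix entries has at most
  \<open>(T + 1)^2\<close> values. \<open>E\<close> does not depend on \<open>z\<close>, so the
  estimate covers all maximizers at once.\<close>

lemma mle_close_in_quadratic_mean:
  assumes \<rho>_pos: "\<And>i. i \<in> {1..nL} \<Longrightarrow> \<rho> i > 0"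
  obtains E where "E \<in> events"
    and "prob E \<le> real nL ^ T * real (T + 1) ^ (2 * n * nL) * exp (- x)"
    and "AE \<omega> in M. \<omega> \<notin> E \<longrightarrow> (\<forall>z. profile_mle nL n T (\<lambda>t j. G t j \<omega>) z \<longrightarrow>
           (\<Sum>t\<in>{1..T}. \<Sum>j\<in>{1..n}. (A_hat T (\<lambda>t j. G t j \<omega>) z (z t) j - A (Z t \<omega>) j)\<^sup>2) < 4 * x)"
proof
  define I where "I = (\<Pi>\<^sub>E t\<in>{1..T}. {1..nL}) \<times> (\<Pi>\<^sub>E i\<in>{1..nL}. \<Pi>\<^sub>E j\<in>{1..n}. fractions T)"
  define F where "F = (\<lambda>(z :: nat \<Rightarrow> nat, B :: nat \<Rightarrow> nat \<Rightarrow> real). {\<omega>\<in>space M. exp x \<le> (\<Prod>t\<in>{1..T}. \<Prod>j\<in>{1..n}.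
      tilted_root_ratio (B (z t) j) (A (Z t \<omega>) j) (G t j \<omega>))})"
  define E where "E = (\<Union>k\<in>I. F k)"
  have finI: "finite I"
    unfolding I_def by (intro finite_cartesian_product finite_PiE finite_fractions) auto
  have F: "F k \<in> events \<and> prob (F k) \<le> exp (- x)" if k: "k \<in> I" for k
  proof -
    obtain z B where zB: "k = (z, B)" by (cases k)
    have "B (z t) j \<in> {0..1}" if "t \<in> {1..T}" "j \<in> {1..n}" for t j
    proof -
      have "B \<in> (\<Pi>\<^sub>E i\<in>{1..nL}. \<Pi>\<^sub>E j\<in>{1..n}. fractions T)" "z t \<in> {1..nL}"
        using k zB that by (auto simp: I_def)
      then have "B (z t) j \<in> fractions T" using that(2) by blast
      then show ?thesis by (simp add: fractions_def)
    qed
    from prob_tilted_likelihood_ratio[OF \<rho>_pos this, where x=x] show ?thesis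
      by (simp add: F_def zB)
  qed
  show "E \<in> events" unfolding E_def using finI F by blast
  have "prob E \<le> (\<Sum>k\<in>I. prob (F k))"
    unfolding E_def using finI F by (intro measure_UNION_le) auto
  also have "\<dots> \<le> (\<Sum>k\<in>I. exp (- x))"
    using F by (intro sum_mono) auto
  also have "\<dots> = real (card I) * exp (- x)" by simp
  also have "card I = nL ^ T * (card (fractions T) ^ n) ^ nL"
    by (simp add: I_def card_cartesian_product card_PiE)
  also have "real \<dots> \<le> real (nL ^ T * (((T + 1)\<^sup>2) ^ n) ^ nL)"
    by (intro of_nat_mono mult_left_mono power_mono card_fractions_le) auto
  also have "\<dots> = real nL ^ T * real (T + 1) ^ (2 * n * nL)"
    by (simp flip: power_mult)
  finally show "prob E \<le> real nL ^ T * real (T + 1) ^ (2 * n * nL) * exp (- x)"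
    by simp
  have "AE \<omega> in M. \<forall>t\<in>{1..T}. \<forall>j\<in>{1..n}. 0 < bern (A (Z t \<omega>) j) (G t j \<omega>)"
    using \<rho>_pos by (rule AE_bern_pos)
  then show "AE \<omega> in M. \<omega> \<notin> E \<longrightarrow> (\<forall>z. profile_mle nL n T (\<lambda>t j. G t j \<omega>) z \<longrightarrow>
           (\<Sum>t\<in>{1..T}. \<Sum>j\<in>{1..n}. (A_hat T (\<lambda>t j. G t j \<omega>) z (z t) j - A (Z t \<omega>) j)\<^sup>2) < 4 * x)"
    using AE_space
  proof eventually_elim
    case (elim \<omega>)
    show ?case
    proof (intro impI allI)
      fix z assume nE: "\<omega> \<notin> E" and mle: "profile_mle nL n T (\<lambda>t j. G t j \<omega>) z"
      define D where "D = (\<Sum>t\<in>{1..T}. \<Sum>j\<in>{1..n}. (A_hat T (\<lambda>t j. G t j \<omega>) z (z t) j - A (Z t \<omega>) j)\<^sup>2)"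
      \<comment> \<open>Members of \<open>I\<close> are extensional, so frequencies and assignment
        are restricted to their index sets.\<close>
      define B where "B = (\<lambda>i\<in>{1..nL}. \<lambda>j\<in>{1..n}. A_hat T (\<lambda>t j. G t j \<omega>) z i j)"
      define z' where "z' = restrict z {1..T}"
      have z: "z t \<in> {1..nL}" if "t \<in> {1..T}" for t
        using mle that by (auto simp: profile_mle_def is_arg_max_def feasible_def)
      have "(z', B) \<in> I"
        unfolding I_def B_def z'_def using z A_hat_in_fractions by auto
      then have outside: "(\<Prod>t\<in>{1..T}. \<Prod>j\<in>{1..n}. tilted_root_ratio (B (z' t) j) (A (Z t \<omega>) j) (G t j \<omega>)) < exp x"
        using nE elim(2) unfolding E_def F_def by (force simp: not_le)
      have eq: "(\<Prod>t\<in>{1..T}. \<Prod>j\<in>{1..n}. tilted_root_ratio (B (z' t) j) (A (Z t \<omega>) j) (G t j \<omega>))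
        = (\<Prod>t\<in>{1..T}. \<Prod>j\<in>{1..n}.
            tilted_root_ratio (A_hat T (\<lambda>t j. G t j \<omega>) z (z t) j) (A (Z t \<omega>) j) (G t j \<omega>))"
        using z by (intro prod.cong) (auto simp: B_def z'_def)
      have "exp (D / 4) < exp x"
        unfolding D_def
        by (rule le_less_trans[OF exp_distance_le_tilted_ratio_of_mle[OF mle feasible_Z[OF elim(2,1)] A_unit]
              outside[unfolded eq]]) (use elim(1) in auto)
      then show "D < 4 * x" by simp
    qed
  qed
qed

section \<open>Concentration of the counts in the true classes\<close>

lemma prob_hub_and_node:
  assumes t: "t \<in> {1..T}" and i: "i \<in> {1..nL}" and j: "j \<in> {1..n}" and "\<rho> i > 0"
  shows "prob {\<omega>\<in>space M. Z t \<omega> = i \<and> G t j \<omega>} = \<rho> i * A i j"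
  using G_cond_prob[OF t i \<open>\<rho> i > 0\<close> j] Z_prob[OF t i] \<open>\<rho> i > 0\<close>
  by (simp add: cond_prob_def field_simps conj_commute)

text \<open>Hoeffding's inequality for the indicators of \<open>Z t = i \<and> G t j\<close> and a
  union bound over the pairs \<open>(i, j)\<close>. Joint counts keep the summands independent over
  a fixed index set; the case \<open>j = i\<close> later yields the class sizes.\<close>

lemma hub_and_node_counts_concentrate:
  assumes \<rho>_pos: "\<And>i. i \<in> {1..nL} \<Longrightarrow> \<rho> i > 0" and "T > 0" "\<eta> > 0"
  obtains E where "E \<in> events" and "prob E \<le> 2 * real nL * real n * exp (- 2 * \<eta>\<^sup>2 * real T)"
    and "\<And>\<omega> i j. \<omega> \<in> space M \<Longrightarrow> \<omega> \<notin> E \<Longrightarrow> i \<in> {1..nL} \<Longrightarrow> j \<in> {1..n} \<Longrightarrow>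
      \<bar>real (card {t\<in>{1..T}. Z t \<omega> = i \<and> G t j \<omega>}) - real T * (\<rho> i * A i j)\<bar> < \<eta> * real T"
proof
  define X where "X i j t \<omega> = (of_bool (Z t \<omega> = i \<and> G t j \<omega>) :: real)" for i j t \<omega>
  define F where "F = (\<lambda>(i, j). {\<omega>\<in>space M. \<bar>(\<Sum>t\<in>{1..T}. X i j t \<omega>) - real T * (\<rho> i * A i j)\<bar> \<ge> \<eta> * real T})"
  define E where "E = (\<Union>k\<in>{1..nL}\<times>{1..n}. F k)"
  have F: "F k \<in> events \<and> prob (F k) \<le> 2 * exp (- 2 * \<eta>\<^sup>2 * real T)" if k: "k \<in> {1..nL}\<times>{1..n}" for k
  proof -
    obtain i j where ij: "k = (i, j)" "i \<in> {1..nL}" "j \<in> {1..n}" using k by auto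
    have X_mean: "expectation (X i j t) = \<rho> i * A i j" if t: "t \<in> {1..T}" for t
    proof -
      have "expectation (X i j t) = expectation (indicator {\<omega>\<in>space M. Z t \<omega> = i \<and> G t j \<omega>})"
        by (intro Bochner_Integration.integral_cong) (auto simp: X_def indicator_def)
      then show ?thesis
        using prob_hub_and_node[OF t ij(2,3) \<rho>_pos[OF ij(2)]]
        by (simp add: Int_def conj_commute)
    qed
    have indep: "indep_vars (\<lambda>_. borel) (X i j) {1..T}"
    proof -
      have "(\<lambda>(h, g). (of_bool (h = i \<and> g j) :: real))
          \<in> borel_measurable (count_space UNIV \<Otimes>\<^sub>M (\<Pi>\<^sub>M j\<in>{1..n}. count_space UNIV))"
      proof (rule measurable_pair_measure_countable1)
        fix h :: nat
        show "(\<lambda>y. case (h, y) of (h, g) \<Rightarrow> (of_bool (h = i \<and> g j) :: real))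
            \<in> borel_measurable (\<Pi>\<^sub>M j\<in>{1..n}. count_space UNIV)"
          unfolding prod.case
          by (rule measurable_compose[OF measurable_component_singleton[OF ij(3)]]) simp
      qed auto
      then have "indep_vars (\<lambda>_. borel)
          (\<lambda>t \<omega>. (\<lambda>(h, g). (of_bool (h = i \<and> g j) :: real)) (Z t \<omega>, \<lambda>j\<in>{1..n}. G t j \<omega>)) {1..T}"
        by (rule indep_vars_compose2[OF indep_observations])
      then show ?thesis using ij(3) by (simp add: X_def[abs_def])
    qed
    interpret H: Hoeffding_ineq M "{1..T}" "X i j" "\<lambda>_. 0" "\<lambda>_. 1" "\<Sum>t\<in>{1..T}. expectation (X i j t)"
    proof unfold_locales
      show "indep_vars (\<lambda>_. borel) (X i j) {1..T}" by (rule indep)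
      show "AE \<omega> in M. X i j t \<omega> \<in> {0..1}" for t by (simp add: X_def)
    qed simp_all
    have sum_mean: "(\<Sum>t\<in>{1..T}. expectation (X i j t)) = real T * (\<rho> i * A i j)"
      using X_mean by simp
    have "- 2 * (\<eta> * real T)\<^sup>2 / (\<Sum>t\<in>{1..T}. (1 - 0)\<^sup>2) = - 2 * \<eta>\<^sup>2 * real T"
      using \<open>T > 0\<close> by (simp add: power2_eq_square)
    moreover have "prob (F k) \<le> 2 * exp (- 2 * (\<eta> * real T)\<^sup>2 / (\<Sum>t\<in>{1..T}. (1 - 0)\<^sup>2))"
      unfolding F_def ij(1) prod.case sum_mean[symmetric]
      using \<open>T > 0\<close> \<open>\<eta> > 0\<close> by (intro H.Hoeffding_ineq_abs_ge) auto
    moreover have "F k \<in> events"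
      unfolding F_def ij(1) prod.case using H.random_variable by measurable
    ultimately show ?thesis by (simp only: simp_thms)
  qed
  show "E \<in> events" unfolding E_def using F by blast
  have "prob E \<le> (\<Sum>k\<in>{1..nL}\<times>{1..n}. prob (F k))"
    unfolding E_def using F by (intro measure_UNION_le) auto
  also have "\<dots> \<le> (\<Sum>k\<in>{1..nL}\<times>{1..n}. 2 * exp (- 2 * \<eta>\<^sup>2 * real T))"
    using F by (intro sum_mono) auto
  finally show "prob E \<le> 2 * real nL * real n * exp (- 2 * \<eta>\<^sup>2 * real T)"
    by (simp add: algebra_simps)
  show "\<bar>real (card {t\<in>{1..T}. Z t \<omega> = i \<and> G t j \<omega>}) - real T * (\<rho> i * A i j)\<bar> < \<eta> * real T"
    if "\<omega> \<in> space M" "\<omega> \<notin> E" "i \<in> {1..nL}" "j \<in> {1..n}" for \<omega> i j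
  proof -
    have "(\<Sum>t\<in>{1..T}. X i j t \<omega>) = real (card {t\<in>{1..T}. Z t \<omega> = i \<and> G t j \<omega>})"
      unfolding X_def by (subst card_eq_sum, subst of_nat_sum, rule sum.mono_neutral_cong_right) auto
    moreover have "\<omega> \<notin> F (i, j)" using that unfolding E_def by blast
    ultimately show ?thesis
      using that(1) by (simp add: F_def not_le del: of_nat_sum)
  qed
qed

end

section \<open>From small quadratic distance to correct labels\<close>

text \<open>The single row \<open>q i\<close> cannot be close on \<open>V\<close> to both
  \<open>A a\<close> and \<open>A b\<close>. Both classes have at least \<open>m\<close> members in
  cluster \<open>i\<close>, so the unavoidable discrepancy is paid at least \<open>m\<close> times
  out of the total distance.\<close>

lemma cell_overlap_le:
  fixes q A :: "nat \<Rightarrow> nat \<Rightarrow> real" and z z0 :: "nat \<Rightarrow> nat" and n T :: nat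
  assumes dist: "(\<Sum>t\<in>{1..T}. \<Sum>j\<in>{1..n}. (q (z t) j - A (z0 t) j)\<^sup>2) \<le> s"
    and V: "V \<subseteq> {1..n}" "\<And>j. j \<in> V \<Longrightarrow> d \<le> A a j - A b j" and d: "0 \<le> d"
    and ab: "a \<noteq> b"
  shows "min (real (card {t\<in>{1..T}. z t = i \<and> z0 t = a})) (real (card {t\<in>{1..T}. z t = i \<and> z0 t = b}))
      * (real (card V) * d\<^sup>2) \<le> 2 * s"
proof -
  define C where "C c = {t\<in>{1..T}. z t = i \<and> z0 t = c}" for c
  define P where "P c = (\<Sum>j\<in>V. (q i j - A c j)\<^sup>2)" for c
  define m where "m = min (real (card (C a))) (real (card (C b)))"
  have finC: "finite (C c)" for c by (simp add: C_def)
  have finV: "finite V" using V(1) finite_subset by blast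
  have P_nonneg: "0 \<le> P c" for c by (auto simp: P_def intro: sum_nonneg)
  have part: "(\<Sum>t\<in>C c. \<Sum>j\<in>V. (q (z t) j - A (z0 t) j)\<^sup>2) = real (card (C c)) * P c" for c
    by (simp add: C_def P_def)
  have "real (card V) * d\<^sup>2 = (\<Sum>j\<in>V. d\<^sup>2)" by simp
  also have "\<dots> \<le> (\<Sum>j\<in>V. 2 * ((q i j - A a j)\<^sup>2 + (q i j - A b j)\<^sup>2))"
  proof (rule sum_mono)
    fix j assume "j \<in> V"
    then have "d\<^sup>2 \<le> (A a j - A b j)\<^sup>2" using V(2) d by (intro power_mono) auto
    \<comment> \<open>With \<open>x\<close>, \<open>y\<close> the two bracketed differences, this
      gives \<open>(x - y)^2 \<le> 2 * (x^2 + y^2)\<close>.\<close>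
    moreover have "0 \<le> ((q i j - A a j) + (q i j - A b j))\<^sup>2" by simp
    ultimately show "d\<^sup>2 \<le> 2 * ((q i j - A a j)\<^sup>2 + (q i j - A b j)\<^sup>2)"
      by (simp add: power2_eq_square algebra_simps)
  qed
  also have "\<dots> = 2 * (P a + P b)"
    by (simp add: P_def sum.distrib sum_distrib_left)
  finally have "m * (real (card V) * d\<^sup>2) \<le> m * (2 * (P a + P b))"
    by (intro mult_left_mono) (auto simp: m_def)
  also have "\<dots> = 2 * (m * P a + m * P b)" by (simp add: algebra_simps)
  also have "\<dots> \<le> 2 * (real (card (C a)) * P a + real (card (C b)) * P b)"
    using P_nonneg by (intro mult_left_mono add_mono mult_right_mono) (auto simp: m_def)
  also have "real (card (C a)) * P a + real (card (C b)) * P b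
      = (\<Sum>t\<in>C a \<union> C b. \<Sum>j\<in>V. (q (z t) j - A (z0 t) j)\<^sup>2)"
    unfolding part[symmetric] using ab
    by (intro sum.union_disjoint[symmetric] finC) (auto simp: C_def)
  also have "\<dots> \<le> (\<Sum>t\<in>{1..T}. \<Sum>j\<in>V. (q (z t) j - A (z0 t) j)\<^sup>2)"
    by (intro sum_mono2) (auto simp: C_def intro: sum_nonneg)
  also have "\<dots> \<le> (\<Sum>t\<in>{1..T}. \<Sum>j\<in>{1..n}. (q (z t) j - A (z0 t) j)\<^sup>2)"
    using V(1) by (intro sum_mono sum_mono2) auto
  also have "\<dots> \<le> s" by (rule dist)
  finally show ?thesis unfolding m_def C_def by simp
qed

lemma card_Collect_le_sum_fibres:
  assumes "finite S" "\<And>t. t \<in> S \<Longrightarrow> P t \<Longrightarrow> f t \<in> I" "finite I"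
  shows "card {t\<in>S. P t} \<le> (\<Sum>i\<in>I. card {t\<in>S. P t \<and> f t = i})"
proof -
  have "{t\<in>S. P t} \<subseteq> (\<Union>i\<in>I. {t\<in>S. P t \<and> f t = i})" using assms(2) by auto
  then have "card {t\<in>S. P t} \<le> card (\<Union>i\<in>I. {t\<in>S. P t \<and> f t = i})"
    using assms by (intro card_mono) auto
  also have "\<dots> \<le> (\<Sum>i\<in>I. card {t\<in>S. P t \<and> f t = i})"
    by (rule card_UN_le[OF assms(3)])
  finally show ?thesis .
qed

text \<open>
  Overlap of two true classes in one estimated cluster is at most \<open>\<tau> T\<close>, so the true classes and the
  estimated clusters correspond up to a permutation. Feasibility excludes a nontrivial permutation.
\<close>

lemma A_hat_close_of_small_overlap:
  fixes A :: "nat \<Rightarrow> nat \<Rightarrow> real" and z z0 :: "nat \<Rightarrow> nat"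
  assumes T: "T > 0" and Kn: "K \<le> n"
    and z: "\<And>t. t \<in> {1..T} \<Longrightarrow> z t \<in> {1..K} \<and> g t (z t)"
    and z0: "\<And>t. t \<in> {1..T} \<Longrightarrow> z0 t \<in> {1..K} \<and> g t (z0 t)"
    and counts: "\<And>i j. i \<in> {1..K} \<Longrightarrow> j \<in> {1..n} \<Longrightarrow>
       \<bar>real (card {t\<in>{1..T}. z0 t = i \<and> g t j}) - real T * (\<rho> i * A i j)\<bar> < \<eta> * real T"
    and overlap: "\<And>i a b. i \<in> {1..K} \<Longrightarrow> a \<in> {1..K} \<Longrightarrow> b \<in> {1..K} \<Longrightarrow> a \<noteq> b \<Longrightarrow>
       min (real (card {t\<in>{1..T}. z t = i \<and> z0 t = a})) (real (card {t\<in>{1..T}. z t = i \<and> z0 t = b}))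
         \<le> \<tau> * real T"
    and A: "\<And>i j. i \<in> {1..K} \<Longrightarrow> j \<in> {1..n} \<Longrightarrow> A i j \<in> {0..1}"
    and diag: "\<And>i. i \<in> {1..K} \<Longrightarrow> A i i = 1"
    and off_diag: "\<And>i i'. i \<in> {1..K} \<Longrightarrow> i' \<in> {1..K} \<Longrightarrow> i \<noteq> i' \<Longrightarrow> A i i' \<le> 1 - \<delta>"
    and \<rho>: "\<And>i. i \<in> {1..K} \<Longrightarrow> r \<le> \<rho> i"
    and pos: "0 \<le> \<tau>" "0 < \<eta>" "0 < \<delta>" "0 < r"
    and small1: "real K * \<tau> + \<eta> < r" and small2: "real K * \<tau> + 2 * \<eta> \<le> r * \<delta>"
    and ij: "i \<in> {1..K}" "j \<in> {1..n}"
  shows "\<bar>A_hat T g z i j - A i j\<bar> \<le> 2 * (real K * \<tau> + \<eta>) / (r - (real K * \<tau> + \<eta>))"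
proof -
  define N where "N i a = real (card {t\<in>{1..T}. z t = i \<and> z0 t = a})" for i a
  define c where "c P = real (card {t\<in>{1..T}. P t})" for P
  have c_mono: "c P \<le> c Q" if "\<And>t. t \<in> {1..T} \<Longrightarrow> P t \<Longrightarrow> Q t" for P Q
    unfolding c_def using that by (intro of_nat_mono card_mono) auto
  have c_split: "c P = c (\<lambda>t. P t \<and> Q t) + c (\<lambda>t. P t \<and> \<not> Q t)" for P Q
  proof -
    have "{t\<in>{1..T}. P t} = {t\<in>{1..T}. P t \<and> Q t} \<union> {t\<in>{1..T}. P t \<and> \<not> Q t}" by auto
    then have "card {t\<in>{1..T}. P t} = card {t\<in>{1..T}. P t \<and> Q t} + card {t\<in>{1..T}. P t \<and> \<not> Q t}"
      by (simp add: card_Un_disjoint disjoint_iff)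
    then show ?thesis by (simp add: c_def)
  qed
  have c_empty: "c P \<le> \<tau> * real T" if "\<And>t. t \<in> {1..T} \<Longrightarrow> \<not> P t" for P
  proof -
    have "{t\<in>{1..T}. P t} = {}" using that by auto
    then show ?thesis using pos(1) by (simp add: c_def del: Collect_empty_eq)
  qed
  have c_fibres: "c P \<le> (\<Sum>i\<in>{1..K}. c (\<lambda>t. P t \<and> f t = i))"
    if "\<And>t. t \<in> {1..T} \<Longrightarrow> P t \<Longrightarrow> f t \<in> {1..K}" for P f
    unfolding c_def of_nat_sum[symmetric] using that
    by (intro of_nat_mono card_Collect_le_sum_fibres) auto
  have class_size: "\<bar>c (\<lambda>t. z0 t = a) - real T * \<rho> a\<bar> < \<eta> * real T" if a: "a \<in> {1..K}" for a
  proof -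
    \<comment> \<open>Every group contains its true hub and \<open>A a a = 1\<close>, so the class
      size is the joint count at node \<open>a\<close>.\<close>
    have "c (\<lambda>t. z0 t = a) = c (\<lambda>t. z0 t = a \<and> g t a)"
      using z0 by (intro antisym c_mono) auto
    then show ?thesis using counts[of a a] diag[OF a] a Kn by (simp add: c_def)
  qed
  \<comment> \<open>Pigeonhole: otherwise class \<open>a\<close> would have at most
    \<open>K * \<tau> * T\<close> members, but it has more than \<open>(r - \<eta>) * T\<close>,
    contradicting \<open>small1\<close>.\<close>
  have "\<exists>i\<in>{1..K}. \<tau> * real T < N i a" if a: "a \<in> {1..K}" for a
  proof (rule ccontr)
    assume "\<not> ?thesis"
    then have "c (\<lambda>t. z0 t = a \<and> z t = i) \<le> \<tau> * real T" if "i \<in> {1..K}" for i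
      using that by (auto simp: N_def c_def conj_commute not_less)
    moreover have "c (\<lambda>t. z0 t = a) \<le> (\<Sum>i\<in>{1..K}. c (\<lambda>t. z0 t = a \<and> z t = i))"
      by (rule c_fibres) (use z in auto)
    ultimately have "c (\<lambda>t. z0 t = a) \<le> (\<Sum>i\<in>{1..K}. \<tau> * real T)"
      by (meson order_trans sum_mono)
    then have "real T * \<rho> a < (real K * \<tau> + \<eta>) * real T"
      using class_size[OF a] by (simp add: algebra_simps)
    also have "\<dots> \<le> r * real T" using small1 by (intro mult_right_mono) auto
    finally show False using \<rho>[OF a] T by (simp add: mult.commute)
  qed
  then obtain \<pi> where \<pi>: "\<And>a. a \<in> {1..K} \<Longrightarrow> \<pi> a \<in> {1..K} \<and> \<tau> * real T < N (\<pi> a) a"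
    by metis
  \<comment> \<open>The cell of \<open>a\<close> in cluster \<open>\<pi> a\<close> is large, so the
    overlap bound must hold through the other cell. Hence no cluster has two large cells, and
    \<open>\<pi>\<close> is an injective self-map of a finite set, a permutation.\<close>
  have small_cell: "N (\<pi> a) b \<le> \<tau> * real T" if "a \<in> {1..K}" "b \<in> {1..K}" "b \<noteq> a" for a b
    using overlap[of "\<pi> a" a b] \<pi>[OF that(1)] that by (auto simp: N_def min_def split: if_splits)
  have "inj_on \<pi> {1..K}"
  proof (rule inj_onI)
    fix a b assume ab: "a \<in> {1..K}" "b \<in> {1..K}" "\<pi> a = \<pi> b"
    then show "a = b" using small_cell[OF ab(1,2)] \<pi>[OF ab(2)] by force
  qed
  then have \<pi>_surj: "\<pi> ` {1..K} = {1..K}"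
    using \<pi> by (intro endo_inj_surj) auto
  \<comment> \<open>Every cluster other than \<open>\<pi> a\<close> is dominated by another class,
    so nearly all of class \<open>a\<close> lies in cluster \<open>\<pi> a\<close>, where
    feasibility puts node \<open>\<pi> a\<close> into every group. Its frequency in class
    \<open>a\<close> is then nearly 1, against \<open>off_diag\<close>. Two errors
    \<open>\<eta>\<close> occur, from the class size and from the joint count.\<close>
  have \<pi>_id: "\<pi> a = a" if a: "a \<in> {1..K}" for a
  proof (rule ccontr)
    assume ne: "\<pi> a \<noteq> a"
    have \<pi>a: "\<pi> a \<in> {1..K}" "\<pi> a \<in> {1..n}" using \<pi>[OF a] Kn by auto
    have "c (\<lambda>t. z0 t = a \<and> \<not> g t (\<pi> a)) \<le> c (\<lambda>t. z0 t = a \<and> z t \<noteq> \<pi> a)"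
      using z by (intro c_mono) metis
    also have "\<dots> \<le> (\<Sum>i\<in>{1..K}. c (\<lambda>t. (z0 t = a \<and> z t \<noteq> \<pi> a) \<and> z t = i))"
      by (intro c_fibres) (use z in auto)
    also have "\<dots> \<le> (\<Sum>i\<in>{1..K}. \<tau> * real T)"
    proof (rule sum_mono)
      fix i assume "i \<in> {1..K}"
      then have "i \<in> \<pi> ` {1..K}" by (simp only: \<pi>_surj)
      then obtain b where b: "b \<in> {1..K}" "i = \<pi> b" by blast
      show "c (\<lambda>t. (z0 t = a \<and> z t \<noteq> \<pi> a) \<and> z t = i) \<le> \<tau> * real T"
      proof (cases "b = a")
        case True
        then show ?thesis using b by (intro c_empty) auto
      next
        case False
        have "c (\<lambda>t. (z0 t = a \<and> z t \<noteq> \<pi> a) \<and> z t = i) \<le> N i a"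
          unfolding N_def c_def[symmetric] by (intro c_mono) auto
        also have "\<dots> \<le> \<tau> * real T"
          using small_cell[OF b(1) a] False b by auto
        finally show ?thesis .
      qed
    qed
    finally have "c (\<lambda>t. z0 t = a \<and> \<not> g t (\<pi> a)) \<le> real K * \<tau> * real T" by simp
    moreover have "c (\<lambda>t. z0 t = a) = c (\<lambda>t. z0 t = a \<and> g t (\<pi> a)) + c (\<lambda>t. z0 t = a \<and> \<not> g t (\<pi> a))"
      by (rule c_split)
    ultimately have "real T * \<rho> a - \<eta> * real T < real T * (\<rho> a * A a (\<pi> a)) + \<eta> * real T + real K * \<tau> * real T"
      using class_size[OF a] counts[OF a \<pi>a(2)] by (simp add: c_def)
    then have "real T * (\<rho> a * (1 - A a (\<pi> a))) < real T * (real K * \<tau> + 2 * \<eta>)"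
      by (simp add: algebra_simps)
    then have "\<rho> a * (1 - A a (\<pi> a)) < real K * \<tau> + 2 * \<eta>" using T by simp
    moreover have "r * \<delta> \<le> \<rho> a * (1 - A a (\<pi> a))"
      using \<rho>[OF a] off_diag[OF a \<pi>a(1)] ne pos by (intro mult_mono) auto
    ultimately show False using small2 by simp
  qed
  have cell: "N i a \<le> \<tau> * real T" if "i \<in> {1..K}" "a \<in> {1..K}" "a \<noteq> i" for i a
    using small_cell[OF that(1,2)] \<pi>_id[OF that(1)] that by simp
  \<comment> \<open>Observations wrongly placed in cluster \<open>i\<close>, and then those of class
    \<open>i\<close> placed elsewhere, fill off-diagonal cells, each with at most
    \<open>\<tau> * T\<close> members.\<close>
  have excess: "c (\<lambda>t. z t = i \<and> z0 t \<noteq> i) \<le> real K * \<tau> * real T"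
  proof -
    have "c (\<lambda>t. z t = i \<and> z0 t \<noteq> i) \<le> (\<Sum>a\<in>{1..K}. c (\<lambda>t. (z t = i \<and> z0 t \<noteq> i) \<and> z0 t = a))"
      by (intro c_fibres) (use z0 in auto)
    also have "\<dots> \<le> (\<Sum>a\<in>{1..K}. \<tau> * real T)"
    proof (rule sum_mono)
      fix a assume a: "a \<in> {1..K}"
      show "c (\<lambda>t. (z t = i \<and> z0 t \<noteq> i) \<and> z0 t = a) \<le> \<tau> * real T"
      proof (cases "a = i")
        case True
        then show ?thesis by (intro c_empty) auto
      next
        case False
        have "c (\<lambda>t. (z t = i \<and> z0 t \<noteq> i) \<and> z0 t = a) \<le> N i a"
          unfolding N_def c_def[symmetric] by (intro c_mono) auto
        also have "\<dots> \<le> \<tau> * real T" by (rule cell[OF ij(1) a False])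
        finally show ?thesis .
      qed
    qed
    finally show ?thesis by simp
  qed
  have deficit: "c (\<lambda>t. z0 t = i \<and> z t \<noteq> i) \<le> real K * \<tau> * real T"
  proof -
    have "c (\<lambda>t. z0 t = i \<and> z t \<noteq> i) \<le> (\<Sum>a\<in>{1..K}. c (\<lambda>t. (z0 t = i \<and> z t \<noteq> i) \<and> z t = a))"
      by (intro c_fibres) (use z in auto)
    also have "\<dots> \<le> (\<Sum>a\<in>{1..K}. \<tau> * real T)"
    proof (rule sum_mono)
      fix a assume a: "a \<in> {1..K}"
      show "c (\<lambda>t. (z0 t = i \<and> z t \<noteq> i) \<and> z t = a) \<le> \<tau> * real T"
      proof (cases "a = i")
        case True
        then show ?thesis by (intro c_empty) auto
      next
        case False
        have "c (\<lambda>t. (z0 t = i \<and> z t \<noteq> i) \<and> z t = a) \<le> N a i"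
          unfolding N_def c_def[symmetric] by (intro c_mono) auto
        also have "\<dots> \<le> \<tau> * real T" using cell[OF a ij(1)] False by simp
        finally show ?thesis .
      qed
    qed
    finally show ?thesis by simp
  qed
  define \<kappa> where "\<kappa> = real K * \<tau> + \<eta>"
  \<comment> \<open>Observations in both the cluster and the class cancel, leaving the excess and
    the deficit. Taking \<open>Q\<close> true gives the denominator of \<open>A_hat\<close>, and
    \<open>g t j\<close> its numerator.\<close>
  have transfer: "\<bar>c (\<lambda>t. z t = i \<and> Q t) - c (\<lambda>t. z0 t = i \<and> Q t)\<bar> \<le> real K * \<tau> * real T" for Q
  proof -
    have "c (\<lambda>t. z t = i \<and> Q t) = c (\<lambda>t. (z t = i \<and> Q t) \<and> z0 t = i) + c (\<lambda>t. (z t = i \<and> Q t) \<and> \<not> z0 t = i)"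
      "c (\<lambda>t. z0 t = i \<and> Q t) = c (\<lambda>t. (z0 t = i \<and> Q t) \<and> z t = i) + c (\<lambda>t. (z0 t = i \<and> Q t) \<and> \<not> z t = i)"
      by (rule c_split)+
    moreover have "c (\<lambda>t. (z t = i \<and> Q t) \<and> z0 t = i) = c (\<lambda>t. (z0 t = i \<and> Q t) \<and> z t = i)"
      by (intro antisym c_mono) auto
    moreover have "c (\<lambda>t. (z t = i \<and> Q t) \<and> \<not> z0 t = i) \<le> c (\<lambda>t. z t = i \<and> z0 t \<noteq> i)"
      "c (\<lambda>t. (z0 t = i \<and> Q t) \<and> \<not> z t = i) \<le> c (\<lambda>t. z0 t = i \<and> z t \<noteq> i)"
      by (intro c_mono; auto)+
    moreover have "0 \<le> c P" for P by (simp add: c_def)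
    ultimately show ?thesis using excess deficit by (smt (verit))
  qed
  define s u where "s = c (\<lambda>t. z t = i)" and "u = c (\<lambda>t. z t = i \<and> g t j)"
  have s: "\<bar>s - real T * \<rho> i\<bar> \<le> \<kappa> * real T"
    using transfer[of "\<lambda>_. True"] class_size[OF ij(1)] by (simp add: s_def \<kappa>_def algebra_simps)
  have u: "\<bar>u - real T * (\<rho> i * A i j)\<bar> \<le> \<kappa> * real T"
    using transfer[of "\<lambda>t. g t j"] counts[OF ij] by (simp add: u_def \<kappa>_def c_def algebra_simps)
  have "real T * r \<le> real T * \<rho> i" using \<rho>[OF ij(1)] by (intro mult_left_mono) auto
  then have s_ge: "(r - \<kappa>) * real T \<le> s" using s by (simp add: algebra_simps)
  have \<kappa>: "0 < r - \<kappa>" "0 \<le> \<kappa>" using small1 pos by (auto simp: \<kappa>_def)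
  have s_pos: "0 < s" using \<kappa> T s_ge by (smt (verit) mult_pos_pos of_nat_0_less_iff)
  \<comment> \<open>Numerator and denominator each contribute an error of
    \<open>\<kappa> * T\<close>.\<close>
  have "\<bar>u - A i j * s\<bar> \<le> \<bar>u - real T * (\<rho> i * A i j)\<bar> + \<bar>A i j * (real T * \<rho> i - s)\<bar>"
    by (simp add: algebra_simps abs_if)
  also have "\<bar>A i j * (real T * \<rho> i - s)\<bar> \<le> 1 * (\<kappa> * real T)"
    unfolding abs_mult using A[OF ij] s by (intro mult_mono) (auto simp: abs_minus_commute)
  finally have us: "\<bar>u - A i j * s\<bar> \<le> 2 * \<kappa> * real T" using u by simp
  have "A_hat T g z i j - A i j = (u - A i j * s) / s"
    using s_pos unfolding A_hat_eq_card u_def[unfolded c_def, symmetric] s_def[unfolded c_def, symmetric]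
    by (simp add: field_simps)
  then have "\<bar>A_hat T g z i j - A i j\<bar> = \<bar>u - A i j * s\<bar> / s"
    using s_pos by (simp add: abs_divide)
  also have "\<dots> \<le> (2 * \<kappa> * real T) / ((r - \<kappa>) * real T)"
    using us s_ge s_pos \<kappa> T by (intro frac_le) auto
  also have "\<dots> = 2 * \<kappa> / (r - \<kappa>)" using T by simp
  finally show ?thesis by (simp add: \<kappa>_def)
qed

section \<open>Finite-sample bound on the maximal error\<close>

context asymmetric_hub_model
begin

lemma measurable_max_error:
  assumes zhat: "\<And>t. t \<in> {1..T} \<Longrightarrow> zhat t \<in> measurable M (count_space UNIV)"
  shows "(\<lambda>\<omega>. MAX (i, j) \<in> {1..nL} \<times> {1..n}.
           \<bar>A_hat T (\<lambda>t j. G t j \<omega>) (\<lambda>t. zhat t \<omega>) i j - A i j\<bar>) \<in> borel_measurable M"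
proof (rule borel_measurable_Max)
  fix p assume p: "p \<in> {1..nL} \<times> {1..n}"
  obtain i j where ij: "p = (i, j)" "j \<in> {1..n}" using p by auto
  have in_cluster: "(\<lambda>\<omega>. of_bool (zhat t \<omega> = i) :: real) \<in> borel_measurable M" if "t \<in> {1..T}" for t
    by (rule measurable_compose[OF zhat[OF that]]) simp
  have in_group: "(\<lambda>\<omega>. of_bool (G t j \<omega>) :: real) \<in> borel_measurable M" if "t \<in> {1..T}" for t
    by (rule measurable_compose[OF measurable_G[OF that ij(2)]]) simp
  \<comment> \<open>As a finite sum of indicators, the cluster size is accessible to the
    measurability rules.\<close>
  have size: "real (cluster_size T (\<lambda>t. zhat t \<omega>) i) = (\<Sum>t\<in>{1..T}. of_bool (zhat t \<omega> = i))" for \<omega>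
    unfolding cluster_size_def
    by (subst card_eq_sum, subst of_nat_sum, rule sum.mono_neutral_cong_left) auto
  show "(\<lambda>\<omega>. case p of (i, j) \<Rightarrow>
      \<bar>A_hat T (\<lambda>t j. G t j \<omega>) (\<lambda>t. zhat t \<omega>) i j - A i j\<bar>) \<in> borel_measurable M"
    unfolding ij(1) prod.case A_hat_def size
    by (intro borel_measurable_abs borel_measurable_diff borel_measurable_times borel_measurable_divide
        borel_measurable_sum borel_measurable_const in_cluster in_group)
qed simp

text \<open>Outside one event for the quadratic distance and one for the counts, the deterministic
  label recovery applies almost everywhere. The condition on \<open>x\<close> says that a distance
  of \<open>4 * x\<close> cannot pay for an overlap above \<open>\<tau> * T\<close>.\<close>

lemma prob_max_error_gt:
  assumes mle: "AE \<omega> in M. profile_mle nL n T (\<lambda>t j. G t j \<omega>) (\<lambda>t. zhat t \<omega>)"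
    and T: "T > 0" and n: "n > 0"
    and \<rho>: "\<And>i. i \<in> {1..nL} \<Longrightarrow> r \<le> \<rho> i"
    and separation: "\<And>i. i \<in> {1..nL} \<Longrightarrow> \<exists>V \<subseteq> {1..n}. real (card V) \<ge> v * real n / real nL \<and>
           (\<forall>j\<in>V. \<forall>i'\<in>{1..nL}. i' \<noteq> i \<longrightarrow> A i j - A i' j \<ge> d)"
    and off_diag: "\<And>i i'. i \<in> {1..nL} \<Longrightarrow> i' \<in> {1..nL} \<Longrightarrow> i \<noteq> i' \<Longrightarrow> A i i' \<le> 1 - \<delta>"
    and pos: "0 < \<tau>" "0 < \<eta>" "0 < \<delta>" "0 < r" "0 < d" "0 < v"
    and small1: "real nL * \<tau> + \<eta> < r" and small2: "real nL * \<tau> + 2 * \<eta> \<le> r * \<delta>"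
    and x: "8 * x * real nL \<le> \<tau> * real T * (d\<^sup>2 * v * real n)"
    and \<epsilon>: "2 * (real nL * \<tau> + \<eta>) / (r - (real nL * \<tau> + \<eta>)) \<le> \<epsilon>"
  shows "prob {\<omega>\<in>space M. \<bar>MAX (i, j) \<in> {1..nL} \<times> {1..n}.
             \<bar>A_hat T (\<lambda>t j. G t j \<omega>) (\<lambda>t. zhat t \<omega>) i j - A i j\<bar>\<bar> > \<epsilon>}
    \<le> real nL ^ T * real (T + 1) ^ (2 * n * nL) * exp (- x)
      + 2 * real nL * real n * exp (- 2 * \<eta>\<^sup>2 * real T)" (is "prob ?B \<le> _")
proof -
  have \<rho>_pos: "\<rho> i > 0" if "i \<in> {1..nL}" for i using \<rho>[OF that] pos by simp
  have nL: "nL > 0" using \<rho>_sum by (cases nL) auto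
  obtain E1 where E1: "E1 \<in> events"
    "prob E1 \<le> real nL ^ T * real (T + 1) ^ (2 * n * nL) * exp (- x)"
    "AE \<omega> in M. \<omega> \<notin> E1 \<longrightarrow> (\<forall>z. profile_mle nL n T (\<lambda>t j. G t j \<omega>) z \<longrightarrow>
       (\<Sum>t\<in>{1..T}. \<Sum>j\<in>{1..n}. (A_hat T (\<lambda>t j. G t j \<omega>) z (z t) j - A (Z t \<omega>) j)\<^sup>2) < 4 * x)"
    using mle_close_in_quadratic_mean[where x=x] \<rho>_pos by blast
  obtain E2 where E2: "E2 \<in> events"
    "prob E2 \<le> 2 * real nL * real n * exp (- 2 * \<eta>\<^sup>2 * real T)"
    "\<And>\<omega> i j. \<omega> \<in> space M \<Longrightarrow> \<omega> \<notin> E2 \<Longrightarrow> i \<in> {1..nL} \<Longrightarrow> j \<in> {1..n} \<Longrightarrow>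
      \<bar>real (card {t\<in>{1..T}. Z t \<omega> = i \<and> G t j \<omega>}) - real T * (\<rho> i * A i j)\<bar> < \<eta> * real T"
    using hub_and_node_counts_concentrate[where \<eta>=\<eta>] \<rho>_pos T pos(2) by blast
  have "AE \<omega> in M. \<forall>t\<in>{1..T}. \<forall>j\<in>{1..n}. 0 < bern (A (Z t \<omega>) j) (G t j \<omega>)"
    using \<rho>_pos by (rule AE_bern_pos)
  then have "AE \<omega> in M. \<omega> \<in> ?B \<longrightarrow> \<omega> \<in> E1 \<union> E2"
    using E1(3) mle AE_space
  proof eventually_elim
    case (elim \<omega>)
    define g where "g t j = G t j \<omega>" for t j
    define z where "z t = zhat t \<omega>" for t
    define z0 where "z0 t = Z t \<omega>" for t
    show ?case
    proof (rule ccontr)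
      assume contra: "\<not> (\<omega> \<in> ?B \<longrightarrow> \<omega> \<in> E1 \<union> E2)"
      then have nE: "\<omega> \<notin> E1" "\<omega> \<notin> E2" by auto
      have feas: "feasible nL T g z" "feasible nL T g z0"
        using elim(3) feasible_Z[OF elim(4,1)]
        by (auto simp: profile_mle_def is_arg_max_def g_def[abs_def] z_def[abs_def] z0_def[abs_def])
      have dist: "(\<Sum>t\<in>{1..T}. \<Sum>j\<in>{1..n}. (A_hat T g z (z t) j - A (z0 t) j)\<^sup>2) \<le> 4 * x"
        using elim(2,3) nE(1) unfolding g_def[abs_def] z_def[abs_def] z0_def by (auto intro: less_imp_le)
      have overlap: "min (real (card {t\<in>{1..T}. z t = i \<and> z0 t = a}))
          (real (card {t\<in>{1..T}. z t = i \<and> z0 t = b})) \<le> \<tau> * real T" (is "?m \<le> _")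
        if ab: "a \<in> {1..nL}" "b \<in> {1..nL}" "a \<noteq> b" for i a b
      proof (rule ccontr)
        assume gt: "\<not> ?m \<le> \<tau> * real T"
        obtain V where V: "V \<subseteq> {1..n}" "real (card V) \<ge> v * real n / real nL"
            "\<And>j. j \<in> V \<Longrightarrow> d \<le> A a j - A b j"
          using separation[OF ab(1)] ab(2,3) by metis
        \<comment> \<open>The chain ends in \<open>8 * x < 8 * x\<close>, where 8 is the factor 2 of
          \<open>cell_overlap_le\<close> times the 4 in the distance bound.\<close>
        have "8 * x \<le> \<tau> * real T * (v * real n / real nL * d\<^sup>2)"
          using x nL by (simp add: field_simps)
        also have "\<dots> < ?m * (v * real n / real nL * d\<^sup>2)"
          using gt pos n nL by (intro mult_strict_right_mono) auto
        also have "\<dots> \<le> ?m * (real (card V) * d\<^sup>2)"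
          using V(2) by (intro mult_left_mono mult_right_mono) auto
        also have "\<dots> \<le> 2 * (4 * x)"
          using pos ab(3) by (intro cell_overlap_le[where q="A_hat T g z" and A=A and z=z and ?z0.0=z0, OF dist V(1,3)]) auto
        finally show False by simp
      qed
      have bound: "\<bar>A_hat T g z i j - A i j\<bar> \<le> \<epsilon>" if ij: "i \<in> {1..nL}" "j \<in> {1..n}" for i j
      proof (rule order_trans[OF A_hat_close_of_small_overlap \<epsilon>])
        show "z t \<in> {1..nL} \<and> g t (z t)" "z0 t \<in> {1..nL} \<and> g t (z0 t)" if "t \<in> {1..T}" for t
          using feas that by (auto simp: feasible_def)
        show "\<bar>real (card {t\<in>{1..T}. z0 t = i \<and> g t j}) - real T * (\<rho> i * A i j)\<bar> < \<eta> * real T"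
          if "i \<in> {1..nL}" "j \<in> {1..n}" for i j
          using E2(3)[OF elim(4) nE(2) that] by (simp add: z0_def g_def)
      qed (use T nL_le_n overlap A_unit A_diag off_diag \<rho> pos small1 small2 ij in auto)
      have "(MAX (i, j) \<in> {1..nL} \<times> {1..n}. \<bar>A_hat T g z i j - A i j\<bar>)
         \<in> (\<lambda>(i, j). \<bar>A_hat T g z i j - A i j\<bar>) ` ({1..nL} \<times> {1..n})"
        using nL n by (intro Max_in) auto
      then have "\<bar>MAX (i, j) \<in> {1..nL} \<times> {1..n}. \<bar>A_hat T g z i j - A i j\<bar>\<bar> \<le> \<epsilon>"
        using bound by auto
      then show False
        using contra by (simp add: g_def[abs_def] z_def[abs_def])
    qed
  qed
  then have "prob ?B \<le> prob (E1 \<union> E2)"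
    using E1(1) E2(1) by (intro finite_measure_mono_AE) auto
  also have "\<dots> \<le> prob E1 + prob E2"
    using E1(1) E2(1) by (rule measure_Un_le)
  finally show ?thesis using E1(2) E2(2) by linarith
qed

end

section \<open>Choice of constants and passage to the limit\<close>

theorem theorem5:
  fixes M :: "nat \<Rightarrow> 'a measure"
    and nL :: nat
    and n T :: "nat \<Rightarrow> nat"
    and \<rho> :: "nat \<Rightarrow> nat \<Rightarrow> real"
    and A :: "nat \<Rightarrow> nat \<Rightarrow> nat \<Rightarrow> real"
    and Z :: "nat \<Rightarrow> nat \<Rightarrow> 'a \<Rightarrow> nat"
    and G :: "nat \<Rightarrow> nat \<Rightarrow> nat \<Rightarrow> 'a \<Rightarrow> bool"
    and zhat :: "nat \<Rightarrow> nat \<Rightarrow> 'a \<Rightarrow> nat"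
    and d v :: "nat \<Rightarrow> real"
    and c_min c_max \<delta> :: real
  assumes model: "\<And>k. asymmetric_hub_model (M k) nL (n k) (T k) (\<rho> k) (A k) (Z k) (G k)"
    and n_lim: "filterlim n at_top sequentially"
    and T_lim: "filterlim T at_top sequentially"
    and c_pos: "c_min > 0" "c_max > 0"
    and rho_min: "\<And>k. Min (\<rho> k ` {1..nL}) = c_min / real nL"
    and rho_max: "\<And>k. Max (\<rho> k ` {1..nL}) = c_max / real nL"
    and zhat_measurable:
      "\<And>k t. t \<in> {1..T k} \<Longrightarrow> zhat k t \<in> measurable (M k) (count_space UNIV)"
    and zhat_mle:
      "\<And>k. AE \<omega> in M k. profile_mle nL (n k) (T k) (\<lambda>t j. G k t j \<omega>) (\<lambda>t. zhat k t \<omega>)"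
    and d_range: "\<And>k. d k \<in> {0<..1}"
    and v_range: "\<And>k. v k \<in> {0<..1}"
    and separation:
      "\<And>k i. i \<in> {1..nL} \<Longrightarrow>
         \<exists>V \<subseteq> {1..n k}. real (card V) \<ge> v k * real (n k) / real nL \<and>
           (\<forall>j\<in>V. \<forall>i'\<in>{1..nL}. i' \<noteq> i \<longrightarrow> A k i j - A k i' j \<ge> d k)"
    and delta_pos: "\<delta> > 0"
    and hub_bounded:
      "\<And>k i i'. \<lbrakk>i \<in> {1..nL}; i' \<in> {1..nL}; i \<noteq> i'\<rbrakk> \<Longrightarrow> A k i i' \<le> 1 - \<delta>"
    and rate1: "(\<lambda>k. ln (real (T k)) / ((d k)^2 * v k * real (T k))) \<longlonglongrightarrow> 0"
    and rate2: "filterlim (\<lambda>k. (d k)^4 * (v k)^2 * real (n k)) at_top sequentially"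
    and rate3: "(\<lambda>k. ln (real (n k)) / real (T k)) \<longlonglongrightarrow> 0"
  shows "o_p_one M (\<lambda>k \<omega>.
           MAX (i, j) \<in> {1..nL} \<times> {1..n k}.
             \<bar>A_hat (T k) (\<lambda>t j. G k t j \<omega>) (\<lambda>t. zhat k t \<omega>) i j - A k i j\<bar>)"
  unfolding o_p_one_def
proof (intro conjI allI impI)
  show "(\<lambda>\<omega>. MAX (i, j) \<in> {1..nL} \<times> {1..n k}.
      \<bar>A_hat (T k) (\<lambda>t j. G k t j \<omega>) (\<lambda>t. zhat k t \<omega>) i j - A k i j\<bar>) \<in> borel_measurable (M k)" for k
    by (rule asymmetric_hub_model.measurable_max_error[OF model zhat_measurable])
next
  fix \<epsilon> :: real assume \<epsilon>: "\<epsilon> > 0"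
  define K where "K = real nL"
  have "nL \<noteq> 0"
    using asymmetric_hub_model.\<rho>_sum[OF model[of 0]] by (cases nL) auto
  then have K: "K \<ge> 1" by (simp add: K_def)
  define r where "r = c_min / K"
  have r: "r > 0" using c_pos K by (simp add: r_def)
  have \<rho>_ge: "r \<le> \<rho> k i" if "i \<in> {1..nL}" for k i
    using rho_min[of k] that by (auto simp: r_def K_def intro!: Min_le simp flip: rho_min[of k])
  \<comment> \<open>The bound \<open>r\<close> keeps the denominator \<open>r - \<kappa> / 2\<close>
    at least \<open>r / 2\<close>, \<open>\<epsilon> * r / 2\<close> then makes the error at most
    \<open>\<epsilon>\<close>, and \<open>r * \<delta>\<close> rules out permuted labels.\<close>
  define \<kappa> where "\<kappa> = min (min r (\<epsilon> * r / 2)) (r * \<delta>)"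
  have \<kappa>: "\<kappa> > 0" "\<kappa> \<le> r" "\<kappa> \<le> \<epsilon> * r / 2" "\<kappa> \<le> r * \<delta>"
    using r \<epsilon> delta_pos by (auto simp: \<kappa>_def)
  \<comment> \<open>With \<open>K * \<tau> = \<eta> = \<kappa> / 4\<close> the smallness conditions
    become \<open>\<kappa> / 2 < r\<close> and
    \<open>3 * \<kappa> / 4 \<le> r * \<delta>\<close>.\<close>
  define \<eta> where "\<eta> = \<kappa> / 4"
  define \<tau> where "\<tau> = \<kappa> / (4 * K)"
  have pos: "\<tau> > 0" "\<eta> > 0" using \<kappa> K by (auto simp: \<tau>_def \<eta>_def)
  have K\<tau>: "K * \<tau> = \<kappa> / 4" using K by (simp add: \<tau>_def)
  have err: "2 * (K * \<tau> + \<eta>) / (r - (K * \<tau> + \<eta>)) \<le> \<epsilon>"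
  proof -
    have "2 * (K * \<tau> + \<eta>) / (r - (K * \<tau> + \<eta>)) = \<kappa> / (r - \<kappa> / 2)"
      by (simp add: K\<tau> \<eta>_def)
    also have "\<dots> \<le> (\<epsilon> * r / 2) / (r / 2)"
      using \<kappa> r \<epsilon> by (intro frac_le) auto
    finally show ?thesis using r by simp
  qed
  \<comment> \<open>The logarithm of the bound on the number of candidates, plus \<open>T\<close>:
    the union bound then leaves exactly \<open>exp (- T)\<close>.\<close>
  define x where "x k = real (T k) * (ln K + 1) + 2 * real (n k) * K * ln (real (T k) + 1)" for k

  have T_real: "filterlim (\<lambda>k. real (T k)) at_top sequentially"
    by (rule filterlim_compose[OF filterlim_real_sequentially T_lim])
  have ev_T: "\<forall>\<^sub>F k in sequentially. T k \<ge> 2" and ev_n: "\<forall>\<^sub>F k in sequentially. n k \<ge> 1"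
    using T_lim n_lim by (auto simp: filterlim_at_top)

  have signal: "\<forall>\<^sub>F k in sequentially. 8 * x k * K \<le> \<tau> * real (T k) * ((d k)\<^sup>2 * v k * real (n k))"
  proof -
    \<comment> \<open>Each of the two terms of \<open>x k\<close> may use half of the budget, so 8
      becomes 16. The 64 is 16 times the 2 in \<open>x k\<close> times the 2 in
      \<open>ln (T + 1) \<le> 2 * ln T\<close>.\<close>
    define \<theta> where "\<theta> = \<tau> / (64 * K\<^sup>2)"
    have \<theta>: "\<theta> > 0" using pos K by (simp add: \<theta>_def)
    have "\<forall>\<^sub>F k in sequentially. 16 * K * (ln K + 1) / \<tau> \<le> (d k)^4 * (v k)^2 * real (n k)"
      using rate2 by (auto simp: filterlim_at_top)
    moreover have "\<forall>\<^sub>F k in sequentially. ln (real (T k)) / ((d k)^2 * v k * real (T k)) < \<theta>"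
      using rate1 \<theta> by (rule order_tendstoD)
    ultimately show ?thesis using ev_T ev_n
    proof eventually_elim
      case (elim k)
      have dv: "0 < d k" "d k \<le> 1" "0 < v k" "v k \<le> 1" using d_range[of k] v_range[of k] by auto
      have Tk: "real (T k) \<ge> 2" and nk: "real (n k) \<ge> 1" using elim by auto
      \<comment> \<open>Since \<open>d k\<close> and \<open>v k\<close> are at most 1,
        \<open>rate2\<close> also drives \<open>d^2 * v * n\<close> to infinity, which pays for the
        term of order \<open>T\<close>.\<close>
      have "(d k)^4 * (v k)^2 * real (n k) \<le> (d k)^2 * v k * real (n k)"
        using dv by (intro mult_right_mono mult_mono power_decreasing) (auto simp: power2_eq_square mult_le_one)
      with elim(1) have "16 * K * (ln K + 1) / \<tau> \<le> (d k)^2 * v k * real (n k)" by linarith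
      then have "16 * K * (ln K + 1) \<le> \<tau> * ((d k)^2 * v k * real (n k))"
        using pos by (simp add: field_simps)
      then have "16 * K * (ln K + 1) * real (T k) \<le> \<tau> * ((d k)^2 * v k * real (n k)) * real (T k)"
        by (rule mult_right_mono) simp
      then have 1: "16 * (real (T k) * (ln K + 1)) * K \<le> \<tau> * real (T k) * ((d k)^2 * v k * real (n k))"
        by (simp only: mult_ac)
      \<comment> \<open>The term of order \<open>n * ln T\<close> is paid for by
        \<open>rate1\<close>; \<open>T \<ge> 2\<close> gives \<open>T + 1 \<le> T^2\<close>.\<close>
      have "ln (real (T k) + 1) \<le> ln (real (T k) ^ 2)"
      proof (rule ln_mono)
        have "real (T k) + 1 \<le> 2 * real (T k)" using Tk by simp
        also have "\<dots> \<le> real (T k) ^ 2" using Tk by (simp add: power2_eq_square)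
        finally show "real (T k) + 1 \<le> real (T k) ^ 2" .
      qed simp_all
      also have "\<dots> = 2 * ln (real (T k))"
        using Tk by (simp add: ln_realpow)
      also have "ln (real (T k)) \<le> \<theta> * ((d k)^2 * v k * real (T k))"
        using elim(2) dv Tk by (simp add: pos_divide_less_eq)
      finally have "ln (real (T k) + 1) \<le> 2 * (\<theta> * ((d k)^2 * v k * real (T k)))" by simp
      then have "32 * K\<^sup>2 * real (n k) * ln (real (T k) + 1)
          \<le> 32 * K\<^sup>2 * real (n k) * (2 * (\<theta> * ((d k)^2 * v k * real (T k))))"
        by (intro mult_left_mono) auto
      also have "\<dots> = \<tau> * real (T k) * ((d k)^2 * v k * real (n k))"
        using K by (simp add: \<theta>_def)
      finally have 2: "16 * (2 * real (n k) * K * ln (real (T k) + 1)) * K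
          \<le> \<tau> * real (T k) * ((d k)^2 * v k * real (n k))"
        by (simp add: power2_eq_square algebra_simps)
      show ?case using 1 2 by (simp add: x_def algebra_simps)
    qed
  qed

  \<comment> \<open>Eventually \<open>n \<le> exp (\<eta>^2 * T)\<close>, so the factor
    \<open>n\<close> of the union bound uses up only half of the Hoeffding exponent.\<close>
  have "\<forall>\<^sub>F k in sequentially. ln (real (n k)) / real (T k) < \<eta>\<^sup>2"
    using rate3 pos by (intro order_tendstoD) auto
  then have bound: "\<forall>\<^sub>F k in sequentially. \<P>(\<omega> in M k. \<bar>MAX (i, j) \<in> {1..nL} \<times> {1..n k}.
      \<bar>A_hat (T k) (\<lambda>t j. G k t j \<omega>) (\<lambda>t. zhat k t \<omega>) i j - A k i j\<bar>\<bar> > \<epsilon>)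
      \<le> exp (- real (T k)) + 2 * K * exp (- (\<eta>\<^sup>2 * real (T k)))"
    using signal ev_T ev_n
  proof eventually_elim
    case (elim k)
    have dv: "0 < d k" "0 < v k" using d_range[of k] v_range[of k] by auto
    have Tk: "real (T k) \<ge> 2" and nk: "real (n k) \<ge> 1" using elim by auto
    have "\<P>(\<omega> in M k. \<bar>MAX (i, j) \<in> {1..nL} \<times> {1..n k}.
      \<bar>A_hat (T k) (\<lambda>t j. G k t j \<omega>) (\<lambda>t. zhat k t \<omega>) i j - A k i j\<bar>\<bar> > \<epsilon>)
      \<le> K ^ T k * real (T k + 1) ^ (2 * n k * nL) * exp (- x k)
      + 2 * K * real (n k) * exp (- 2 * \<eta>\<^sup>2 * real (T k))"
      unfolding K_def
    proof (rule asymmetric_hub_model.prob_max_error_gt[OF model zhat_mle])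
      show "real nL * \<tau> + \<eta> < r" "real nL * \<tau> + 2 * \<eta> \<le> r * \<delta>"
        using K\<tau> \<kappa> by (auto simp: K_def \<eta>_def)
    qed (use elim dv pos r delta_pos \<rho>_ge separation hub_bounded err in \<open>auto simp: K_def\<close>)
    also have "K ^ T k * real (T k + 1) ^ (2 * n k * nL) * exp (- x k) = exp (- real (T k))"
    proof -
      have "K ^ T k = exp (real (T k) * ln K)"
        using K by (simp add: exp_of_nat_mult)
      moreover have "real (T k + 1) ^ (2 * n k * nL) = exp (real (2 * n k * nL) * ln (real (T k + 1)))"
        by (subst exp_of_nat_mult) simp
      ultimately show ?thesis
        by (simp add: x_def K_def algebra_simps flip: exp_add)
    qed
    also have "2 * K * real (n k) * exp (- 2 * \<eta>\<^sup>2 * real (T k)) \<le> 2 * K * exp (- (\<eta>\<^sup>2 * real (T k)))"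
    proof -
      have "real (n k) = exp (ln (real (n k)))" using nk by simp
      also have "\<dots> \<le> exp (\<eta>\<^sup>2 * real (T k))"
        using elim(1) Tk by (simp add: pos_divide_less_eq)
      finally have "real (n k) * exp (- 2 * \<eta>\<^sup>2 * real (T k))
          \<le> exp (\<eta>\<^sup>2 * real (T k)) * exp (- 2 * \<eta>\<^sup>2 * real (T k))"
        by (intro mult_right_mono) auto
      also have "\<dots> = exp (- (\<eta>\<^sup>2 * real (T k)))" by (simp flip: exp_add)
      finally show ?thesis using K by (simp add: mult.assoc)
    qed
    finally show ?case by simp
  qed
  have exp_lim: "(\<lambda>k. exp (- (c * real (T k)))) \<longlonglongrightarrow> 0" if "c > 0" for c :: real
    by (rule filterlim_compose[OF exp_at_bot], subst filterlim_uminus_at_bot)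
       (simp add: filterlim_tendsto_pos_mult_at_top[OF tendsto_const that T_real])
  show "(\<lambda>k. \<P>(\<omega> in M k. \<bar>MAX (i, j) \<in> {1..nL} \<times> {1..n k}.
      \<bar>A_hat (T k) (\<lambda>t j. G k t j \<omega>) (\<lambda>t. zhat k t \<omega>) i j - A k i j\<bar>\<bar> > \<epsilon>)) \<longlonglongrightarrow> 0"
  proof (rule tendsto_sandwich[OF _ bound tendsto_const])
    show "(\<lambda>k. exp (- real (T k)) + 2 * K * exp (- (\<eta>\<^sup>2 * real (T k)))) \<longlonglongrightarrow> 0"
      using tendsto_add[OF exp_lim[of 1] tendsto_mult_left[OF exp_lim[of "\<eta>\<^sup>2"], of "2 * K"]] pos by simp
  qed simp
qed

end
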